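(* Let $\mathcal{G}$ be any network, let $i$ be a fixed but arbitrary node such that the upstream subnetwork $\mathcal{U}(i)$ is not acyclic, and let $\rho$ be the Perron eigenvalue of $\mathcal{U}(i)$. Let $g$ be the least common multiple of the periods of the adjacency matrices of those strongly connected components (SCCs) of $\mathcal{U}(i)$ that have Perron eigenvalue $\rho$. Let $a_i(\ell)$ be the number of walks of length $\ell$ in $\mathcal{G}$ terminating at $i$. Then there exist eventually positive real polynomials $R_0(\ell),R_1(\ell),\dots,R_{g-1}(\ell)$ such that, for each $0\le s\le g-1$, $$a_i(\ell)\sim R_s(\ell)\rho^\ell\qquad\text{as } \ell\to\infty\text{ with } \ell\equiv s\pmod g .$$ These polynomials may depend on $i$ but are the same for all nodes in the same SCC of $\mathcal{G}$.
   Context: A network is a finite directed multigraph (self-loops and multiple edges allowed). If its nodes are $1,\dots,n$, its adjacency matrix is the $n\times n$ matrix whose $(i,j)$ entry is the number of edges from $i$ to $j$. A walk of length $\ell$ from $j$ to $i$ is a sequence of nodes and edges $i=x_0\stackrel{e_1}{\leftarrow}x_1\stackrel{e_2}{\leftarrow}\cdots\stackrel{e_\ell}{\leftarrow}x_\ell=j$ with $e_t$ an edge from $x_t$ to $x_{t-1}$ (for $\ell=0$ it is a single node); it terminates at $i$. Different parallel edges give different walks; nodes and edges may repeat. For a set $X$ of nodes, $\mathcal{G}[X]$ is the induced subnetwork: its nodes are the elements of $X$ and its edges are all edges of $\mathcal{G}$ with source and target in $X$. The upstream subnetwork $\mathcal{U}(i)$ is the subnetwork induced by all nodes $j$ for which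 there is a walk (possibly of length $0$) from $j$ to $i$. A network is acyclic if it contains no directed cycle (a self-loop counts as a cycle). A network is strongly connected if for any two distinct nodes there is a walk from the first to the second; a strongly connected component (SCC) is a maximal set $X$ of nodes whose induced subnetwork is strongly connected, also identified with that subnetwork. The Perron eigenvalue of a network is the spectral radius of its adjacency matrix, which is itself an eigenvalue. The period of an irreducible non-negative matrix $M$ (nonzero adjacency matrix of a strongly connected network) is $\gcd\{m>0:(M^m)_{jj}>0\}$, independent of $j$. A real polynomial $P(\ell)$ is eventually positive if there is $L$ with $P(\ell)>0$ for all $\ell\ge L$. $f(\ell)\sim g(\ell)$ means $f(\ell)/g(\ell)\to1$.
   Formalization: The last sentence is false as written (arcs x→x, x→y, y→x: the ratio of the walk counts at x and y tends to the golden ratio); proved instead: for nodes j in the SCC of i the same polynomials R_s serve up to a positive constant factor depending on j and s. *)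

theory Defs
  imports
    "Graph_Theory.Graph_Theory"
    "Jordan_Normal_Form.Spectral_Radius"
    "HOL-Library.Landau_Symbols"
    "HOL-Computational_Algebra.Polynomial"
    "HOL-Number_Theory.Cong"
begin

text \<open>
  A network is a digraph satisfying \<open>fin_digraph\<close>: loops and parallel arcs are allowed. Walks are
  the arc walks \<open>pre_digraph.awalk\<close>, where \<open>awalk j p i\<close> says that the arc list \<open>p\<close>, read from left
  to right along the direction of the arcs, leads from \<open>j\<close> to \<open>i\<close>; the empty list is a walk from
  each node to itself.
\<close>

definition upstream :: "('a,'b) pre_digraph \<Rightarrow> 'a \<Rightarrow> ('a,'b) pre_digraph" where
  "upstream G i = G \<restriction> {j. \<exists>p. pre_digraph.awalk G j p i}"

definition acyclic_network :: "('a,'b) pre_digraph \<Rightarrow> bool" where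
  "acyclic_network G \<longleftrightarrow> (\<nexists>p. pre_digraph.cycle G p)"

text \<open>
  A walk ending at \<open>i\<close> is determined by its list of arcs, also when this list is empty, so counting
  arc lists counts walks.
\<close>

definition num_walks_to :: "('a,'b) pre_digraph \<Rightarrow> 'a \<Rightarrow> nat \<Rightarrow> nat" where
  "num_walks_to G i l = card {p. length p = l \<and> (\<exists>j. pre_digraph.awalk G j p i)}"

text \<open>
  The nodes carry no numbering, so an arbitrary one is fixed. Another choice conjugates the
  adjacency matrix by a permutation matrix, which changes neither its spectral radius nor its period.
\<close>

definition node_list :: "('a,'b) pre_digraph \<Rightarrow> 'a list" where
  "node_list G = (SOME xs. distinct xs \<and> set xs = verts G)"

definition adjacency_matrix :: "('a,'b) pre_digraph \<Rightarrow> nat mat" where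
  "adjacency_matrix G = mat (card (verts G)) (card (verts G))
     (\<lambda>(a, b). card {e \<in> arcs G. tail G e = node_list G ! a \<and> head G e = node_list G ! b})"

definition perron_eigenvalue :: "('a,'b) pre_digraph \<Rightarrow> real" where
  "perron_eigenvalue G = spectral_radius (map_mat of_nat (adjacency_matrix G))"

text \<open>
  For an irreducible matrix the choice of the diagonal position 0 is immaterial. For the
  \<open>1 \<times> 1\<close> zero matrix the value is \<open>Gcd {} = 0\<close>.
\<close>

definition period :: "'a :: linordered_semidom mat \<Rightarrow> nat" where
  "period M = Gcd {m. m > 0 \<and> (M ^\<^sub>m m) $$ (0, 0) > 0}"

text \<open>
  If the network has a cycle, its Perron eigenvalue is at least 1, so no component with a zero
  adjacency matrix enters the least common multiple.
\<close>

definition perron_period_lcm :: "('a,'b) pre_digraph \<Rightarrow> nat" where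
  "perron_period_lcm G = Lcm ((\<lambda>H. period (adjacency_matrix H)) `
     {H \<in> pre_digraph.sccs G. perron_eigenvalue H = perron_eigenvalue G})"

definition eventually_positive :: "real poly \<Rightarrow> bool" where
  "eventually_positive P \<longleftrightarrow> (\<exists>L::nat. \<forall>l\<ge>L. poly P (real l) > 0)"

text \<open>The filter for \<open>l \<rightarrow> \<infinity>\<close> with \<open>l \<equiv> s\<close> modulo \<open>g\<close>.\<close>

definition at_top_cong :: "nat \<Rightarrow> nat \<Rightarrow> nat filter" where
  "at_top_cong s g = inf at_top (principal {l. [l = s] (mod g)})"

text \<open>
  Nodes \<open>x\<close>, \<open>y\<close> of one strongly connected component share \<open>\<rho>\<close> and \<open>g\<close>, and their polynomials can be
  chosen to agree up to positive constant factors, in particular with equal degrees. The factors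
  cannot be dropped: if the arcs are \<open>x \<rightarrow> x\<close>, \<open>x \<rightarrow> y\<close>, \<open>y \<rightarrow> x\<close>, the numbers of walks of length \<open>l\<close>
  ending at \<open>x\<close> and at \<open>y\<close> are consecutive Fibonacci numbers, whose quotient tends to the golden
  ratio. Nor can they be chosen independently of the residue \<open>s\<close>: for one arc \<open>x \<rightarrow> y\<close> and two arcs
  \<open>y \<rightarrow> x\<close> the quotient is 1 for even \<open>l\<close> and 2 for odd \<open>l\<close>.
\<close>

definition walk_asymptotics ::
  "('a,'b) pre_digraph \<Rightarrow> 'a \<Rightarrow> nat \<Rightarrow> nat \<Rightarrow> real poly \<Rightarrow> real \<Rightarrow> bool" where
  "walk_asymptotics G i s g P \<rho> \<longleftrightarrow>
     (\<lambda>l. real (num_walks_to G i l)) \<sim>[at_top_cong s g] (\<lambda>l. poly P (real l) * \<rho> ^ l)"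

end

theory Submission imports Defs
begin

text \<open>
  Let \<open>U\<close> be the upstream subnetwork of \<open>i\<close>, with adjacency matrix \<open>A\<close>, Perron eigenvalue \<open>\<rho>\<close> and
  period multiple \<open>g\<close>. The walks that end at \<open>i\<close> stay in \<open>U\<close>, so their number \<open>a(l)\<close> is a column sum of
  \<open>A ^ l\<close>. By the Jordan normal form every entry of \<open>A ^ l\<close> is a linear combination of sequences
  \<open>(l choose d) * ev ^ (l - d)\<close> with \<open>ev\<close> an eigenvalue (\<open>sequence_closure_matrix_power\<close>). Eigenvalues of
  modulus less than \<open>\<rho>\<close> contribute \<open>o(\<rho> ^ l)\<close>. If the others satisfy \<open>ev ^ g = \<rho> ^ g\<close>, then
  \<open>(ev / \<rho>) ^ l\<close> depends on \<open>l mod g\<close> only, and there are polynomials \<open>Q s\<close> such that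
  \<open>a(l) / \<rho> ^ l - Q (l mod g) (l)\<close> tends to 0 (\<open>num_walks_to_quasi_polynomial\<close>).
  
  The identity \<open>ev ^ g = \<rho> ^ g\<close> is a piece of Perron-Frobenius theory, proved here directly. An
  eigenfunction \<open>x\<close> of \<open>U\<close> restricts to an eigenfunction of some strongly connected component \<open>H\<close>
  (\<open>eigenfunction_on_scc\<close>), which therefore has Perron eigenvalue \<open>\<rho>\<close> too. On \<open>H\<close> the triangle inequality
  shows that \<open>\<bar>x\<bar>\<close> satisfies \<open>A \<bar>x\<bar> \<ge> \<rho> \<bar>x\<bar>\<close>. Strict inequality anywhere would spread over \<open>H\<close> and force
  walks to grow faster than the spectral radius permits; hence \<open>\<bar>x\<bar>\<close> is a positive eigenfunction for \<open>\<rho>\<close>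
  (\<open>peripheral_eigenfunction_modulus\<close>). Equality in the triangle inequality for closed walks of length \<open>m\<close>
  then gives \<open>ev ^ m = \<rho> ^ m\<close> for every return time \<open>m\<close>, hence also for their greatest common divisor, the
  period of \<open>H\<close>, which divides \<open>g\<close>.
  
  It remains to exclude that some \<open>Q s\<close> vanishes or is negative. Every node of \<open>U\<close> leads to \<open>i\<close>, and
  changing the end node of walks along an existing connection changes their number by at most a constant
  factor (\<open>num_walks_to_le_if_reachable\<close>). Together with an eigenfunction for an eigenvalue of modulus \<open>\<rho>\<close>
  this gives \<open>a(l) \<ge> c * \<rho> ^ l\<close> for all \<open>l\<close> with some \<open>c > 0\<close> (\<open>num_walks_to_lower_bound\<close>). So each \<open>Q s\<close> is
  eventually positive, and the additive approximation becomes \<open>a(l) \<sim> Q s (l) * \<rho> ^ l\<close>. For a node \<open>j\<close> in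
  the component of \<open>i\<close> the subnetwork \<open>U\<close> is the same, and the two walk counts bound each other up to
  constants in each residue class; hence the two polynomials have equal degree, and their quotient tends
  to the quotient of the leading coefficients.
\<close>

section \<open>Entries of matrix powers\<close>

text \<open>
  The entry \<open>(a, b)\<close> of the \<open>l\<close>-th power of a Jordan block for \<open>ev\<close> is \<open>(l choose (b - a)) * ev ^ (l - (b - a))\<close> on and
  above the diagonal and 0 below it; entries outside the blocks are 0 as well.
\<close>

lemma sequence_closure_jordan_matrix:
  fixes P :: "(nat \<Rightarrow> complex) \<Rightarrow> bool"
  assumes zero: "P (\<lambda>l. 0)"
    and base: "\<And>m ev d. (m, ev) \<in> set blocks \<Longrightarrow> 0 < m \<Longrightarrow>
      P (\<lambda>l. of_nat (l choose d) * ev ^ (l - d))"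
    and "a < sum_list (map fst blocks)" "b < sum_list (map fst blocks)"
  shows "P (\<lambda>l. (jordan_matrix blocks ^\<^sub>m l) $$ (a, b))"
  using base assms(3,4)
proof (induction blocks arbitrary: a b)
  case Nil
  then show ?case by simp
next
  case (Cons block blocks)
  obtain m ev where block: "block = (m, ev)" by force
  let ?J = "\<lambda>l. jordan_block m ev ^\<^sub>m l" and ?B = "\<lambda>l. jordan_matrix blocks ^\<^sub>m l"
  define N where "N = sum_list (map fst blocks)"
  have dimB: "dim_row (?B l) = N" "dim_col (?B l) = N" for l
    unfolding N_def by (simp_all add: pow_mat_dim)
  have blocks_pow: "jordan_matrix (block # blocks) ^\<^sub>m l = four_block_mat (?J l) (0\<^sub>m m N) (0\<^sub>m N m) (?B l)" for l
    unfolding jordan_matrix_pow using dimB[of l, unfolded jordan_matrix_pow]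
    by (simp add: block Let_def jordan_matrix_pow)
  have ab: "a < m + N" "b < m + N"
    using Cons.prems(2,3) by (auto simp: block N_def)
  have entry: "(jordan_matrix (block # blocks) ^\<^sub>m l) $$ (a, b) =
      (if a < m then if b < m then ?J l $$ (a, b) else 0
       else if b < m then 0 else ?B l $$ (a - m, b - m))" for l
    unfolding blocks_pow using ab dimB by (auto simp: four_block_mat_def Let_def)
  consider "a < m" "b < m" | "a \<ge> m" "b \<ge> m" | "a < m \<longleftrightarrow> \<not> b < m" by linarith
  then show ?case
  proof cases
    case 1
    show ?thesis
    proof (cases "a \<le> b")
      case True
      have "l + a - b = l - (b - a)" for l using True by simp
      moreover have "P (\<lambda>l. of_nat (l choose (b - a)) * ev ^ (l - (b - a)))"
        using Cons.prems(1)[of m ev] 1 block by auto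
      ultimately show ?thesis
        unfolding entry using 1 True by (simp add: jordan_block_pow)
    next
      case False
      then show ?thesis unfolding entry using 1 zero by (simp add: jordan_block_pow)
    qed
  next
    case 2
    have "P (\<lambda>l. ?B l $$ (a - m, b - m))"
      by (rule Cons.IH) (use 2 ab Cons.prems(1) in \<open>auto simp: N_def\<close>)
    then show ?thesis unfolding entry using 2 by simp
  next
    case 3
    then have "(\<lambda>l. (jordan_matrix (block # blocks) ^\<^sub>m l) $$ (a, b)) = (\<lambda>l. 0)"
      unfolding entry by auto
    then show ?thesis using zero by simp
  qed
qed

text \<open>
  With \<open>A = S * J * T\<close>, where \<open>J\<close> is the Jordan normal form and \<open>T\<close> the inverse of \<open>S\<close>, each entry of \<open>A ^ l\<close> is a
  linear combination of the entries of \<open>J ^ l\<close> with coefficients independent of \<open>l\<close>. In the form of an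
  induction principle for sequence predicates this expansion serves twice: once for a growth bound, once for
  the polynomials per residue class.
\<close>

lemma sequence_closure_matrix_power:
  fixes P :: "(nat \<Rightarrow> complex) \<Rightarrow> bool" and A :: "complex mat"
  assumes A: "A \<in> carrier_mat n n"
    and zero: "P (\<lambda>l. 0)"
    and add: "\<And>f h. P f \<Longrightarrow> P h \<Longrightarrow> P (\<lambda>l. f l + h l)"
    and scale: "\<And>c f. P f \<Longrightarrow> P (\<lambda>l. c * f l)"
    and base: "\<And>ev d. eigenvalue A ev \<Longrightarrow> P (\<lambda>l. of_nat (l choose d) * ev ^ (l - d))"
    and ab: "a < n" "b < n"
  shows "P (\<lambda>l. (A ^\<^sub>m l) $$ (a, b))"
proof -
  obtain as where "char_poly A = (\<Prod>a\<leftarrow>as. [:- a, 1:])"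
    using char_poly_factorized[OF A] by auto
  from jordan_nf_exists[OF A this] obtain blocks where jnf: "jordan_nf A blocks" by auto
  obtain S T where S: "S \<in> carrier_mat n n" and T: "T \<in> carrier_mat n n"
    and cp: "char_poly A = (\<Prod>(m, ev)\<leftarrow>blocks. [:- ev, 1:] ^ m)"
    and pow: "\<And>l. A ^\<^sub>m l = S * jordan_matrix blocks ^\<^sub>m l * T"
    using jordan_nf_powE[OF A jnf] by blast
  have size: "sum_list (map fst blocks) = n"
    using arg_cong[OF pow[of 1], of dim_row] pow[of 0] jnf A
    unfolding jordan_nf_def by (metis carrier_matD(1) jordan_matrix_dim(1) similar_mat_def similar_mat_witD(5))
  have sum: "P (\<lambda>l. \<Sum>k\<in>K. f k l)" if "\<And>k. k \<in> K \<Longrightarrow> P (f k)" for f :: "nat \<Rightarrow> nat \<Rightarrow> complex" and K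
    using that
  proof (induction K rule: infinite_finite_induct)
    case (insert k K)
    then show ?case using add[of "f k" "\<lambda>l. \<Sum>k\<in>K. f k l"] by simp
  qed (use zero in simp_all)
  have J: "P (\<lambda>l. (jordan_matrix blocks ^\<^sub>m l) $$ (p, q))" if "p < n" "q < n" for p q
  proof (rule sequence_closure_jordan_matrix[of P, OF zero])
    fix m ev d assume "(m, ev) \<in> set blocks" "0 < m"
    then have "poly (char_poly A) ev = 0"
      unfolding cp by (force simp: poly_prod_list prod_list_zero_iff poly_power)
    then show "P (\<lambda>l. of_nat (l choose d) * ev ^ (l - d))"
      by (intro base) (simp add: eigenvalue_root_char_poly[OF A])
  qed (use that size in auto)
  have entry: "(A ^\<^sub>m l) $$ (a, b) =
      (\<Sum>p<n. \<Sum>q<n. (S $$ (a, p) * T $$ (q, b)) * (jordan_matrix blocks ^\<^sub>m l) $$ (p, q))" for l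
  proof -
    let ?J = "jordan_matrix blocks ^\<^sub>m l"
    have Jc: "?J \<in> carrier_mat n n" using size by (metis jordan_matrix_carrier pow_carrier_mat)
    have "(A ^\<^sub>m l) $$ (a, b) = (\<Sum>p<n. S $$ (a, p) * (\<Sum>q<n. row ?J p $ q * T $$ (q, b)))"
      unfolding pow using S T Jc ab by (simp add: scalar_prod_def atLeast0LessThan)
    also have "\<dots> = (\<Sum>p<n. \<Sum>q<n. (S $$ (a, p) * T $$ (q, b)) * ?J $$ (p, q))"
      using Jc by (auto simp: sum_distrib_left mult_ac intro!: sum.cong)
    finally show ?thesis .
  qed
  show ?thesis unfolding entry
    by (intro sum scale J) auto
qed

section \<open>Quasi-polynomial growth\<close>

lemma power_times_geometric_tendsto_0:
  fixes x :: real
  assumes "0 \<le> x" "x < 1"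
  shows "(\<lambda>l. real l ^ d * x ^ l) \<longlonglongrightarrow> 0"
proof (cases "d = 0")
  case True
  then show ?thesis using assms by (simp add: LIMSEQ_power_zero)
next
  case False
  \<comment> \<open>the sequence is the \<open>d\<close>-th power of \<open>l * y ^ l\<close>\<close>
  define y where "y = root d x"
  have y: "y ^ d = x" "0 \<le> y" "y < 1"
    using False assms by (auto simp: y_def)
  have "(\<lambda>l. real l * y ^ l) \<longlonglongrightarrow> 0"
    using powser_times_n_limit_0[of y] y by simp
  then have "(\<lambda>l. (real l * y ^ l) ^ d) \<longlonglongrightarrow> 0 ^ d"
    by (rule tendsto_power)
  moreover have "(real l * y ^ l) ^ d = real l ^ d * x ^ l" for l
    by (simp add: power_mult_distrib y(1)[symmetric] flip: power_mult) (simp add: mult.commute)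
  ultimately show ?thesis using False by (simp add: zero_power)
qed

text \<open>
  For \<open>l \<ge> d\<close> the modulus is at most \<open>l ^ d * (\<bar>ev\<bar> / r) ^ l\<close> up to a constant factor. The factor is a negative power
  of \<open>\<bar>ev\<bar>\<close>, so that \<open>ev = 0\<close> needs its own case.
\<close>

lemma binomial_geometric_negligible:
  fixes ev :: complex
  assumes "cmod ev < r"
  shows "(\<lambda>l. of_nat (l choose d) * ev ^ (l - d) / of_real r ^ l) \<longlonglongrightarrow> 0"
proof (cases "ev = 0")
  case True
  have "\<forall>\<^sub>F l in sequentially. of_nat (l choose d) * ev ^ (l - d) / of_real r ^ l = 0"
    using eventually_gt_at_top[of d] by eventually_elim (simp add: True)
  then show ?thesis by (rule tendsto_eventually)
next
  case False
  have r: "0 < r" using assms norm_ge_zero[of ev] by linarith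
  define x where "x = cmod ev / r"
  have x: "0 \<le> x" "x < 1" using assms r by (auto simp: x_def)
  have "(\<lambda>l. (real l ^ d * x ^ l) / cmod ev ^ d) \<longlonglongrightarrow> 0 / cmod ev ^ d"
    by (intro tendsto_divide power_times_geometric_tendsto_0 x tendsto_const) (use False in auto)
  then have lim: "(\<lambda>l. (real l ^ d * x ^ l) / cmod ev ^ d) \<longlonglongrightarrow> 0" by simp
  show ?thesis
  proof (rule tendsto_0_le[OF lim, where K = 1])
    show "\<forall>\<^sub>F l in sequentially. norm (of_nat (l choose d) * ev ^ (l - d) / of_real r ^ l)
        \<le> norm (real l ^ d * x ^ l / cmod ev ^ d) * 1"
      using eventually_ge_at_top[of d]
    proof eventually_elim
      case (elim l)
      have "real (l choose d) \<le> real l ^ d"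
        using binomial_le_pow[OF elim] by (metis of_nat_le_iff of_nat_power)
      then have "real (l choose d) * (x ^ l / cmod ev ^ d) \<le> real l ^ d * (x ^ l / cmod ev ^ d)"
        by (intro mult_right_mono) (use x in auto)
      moreover have "norm (of_nat (l choose d) * ev ^ (l - d) / of_real r ^ l) =
          real (l choose d) * (x ^ l / cmod ev ^ d)"
        using r False elim
        by (simp add: norm_mult norm_divide norm_power x_def power_divide power_diff)
      ultimately show ?case using x by simp
    qed
  qed
qed

lemma binomial_polynomial:
  "\<exists>p :: 'a :: field_char_0 poly. \<forall>l. poly p (of_nat l) = of_nat (l choose d)"
proof -
  define p where "p = Polynomial.smult (1 / fact d) (\<Prod>k<d. [:- of_nat k, 1 :: 'a:])"
  have "poly p (of_nat l) = of_nat (l choose d)" for l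
  proof -
    have "poly p (of_nat l) = (of_nat l gchoose d)"
      by (simp add: p_def gbinomial_prod_rev poly_prod atLeast0LessThan)
    then show ?thesis by (simp add: binomial_gbinomial)
  qed
  then show ?thesis by blast
qed

text \<open>
  The remainder has to be \<open>o(1)\<close> rather than of smaller order than the polynomials: only then is the class
  closed under sums in which leading terms cancel. The coefficients are complex because single eigenvalues
  are.
\<close>

definition quasi_polynomial_growth :: "nat \<Rightarrow> real \<Rightarrow> (nat \<Rightarrow> complex) \<Rightarrow> bool" where
  "quasi_polynomial_growth g \<rho> f \<longleftrightarrow> (\<exists>Q :: nat \<Rightarrow> complex poly.
     (\<lambda>l. f l / of_real \<rho> ^ l - poly (Q (l mod g)) (of_nat l)) \<longlonglongrightarrow> 0)"

lemma quasi_polynomial_growthI: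
  assumes "(\<lambda>l. f l / of_real \<rho> ^ l - poly (Q (l mod g)) (of_nat l)) \<longlonglongrightarrow> 0"
  shows "quasi_polynomial_growth g \<rho> f"
  using assms unfolding quasi_polynomial_growth_def by blast

lemma quasi_polynomial_growth_zero: "quasi_polynomial_growth g \<rho> (\<lambda>l. 0)"
  by (rule quasi_polynomial_growthI[where Q = "\<lambda>s. 0"]) simp

lemma quasi_polynomial_growth_add:
  assumes "quasi_polynomial_growth g \<rho> f" "quasi_polynomial_growth g \<rho> h"
  shows "quasi_polynomial_growth g \<rho> (\<lambda>l. f l + h l)"
proof -
  obtain Q R where
    Q: "(\<lambda>l. f l / of_real \<rho> ^ l - poly (Q (l mod g)) (of_nat l)) \<longlonglongrightarrow> 0" and
    R: "(\<lambda>l. h l / of_real \<rho> ^ l - poly (R (l mod g)) (of_nat l)) \<longlonglongrightarrow> 0"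
    using assms unfolding quasi_polynomial_growth_def by blast
  from tendsto_add[OF Q R] show ?thesis
    by (intro quasi_polynomial_growthI[where Q = "\<lambda>s. Q s + R s"]) (simp add: add_divide_distrib algebra_simps)
qed

lemma quasi_polynomial_growth_scale:
  assumes "quasi_polynomial_growth g \<rho> f"
  shows "quasi_polynomial_growth g \<rho> (\<lambda>l. c * f l)"
proof -
  obtain Q where
    Q: "(\<lambda>l. f l / of_real \<rho> ^ l - poly (Q (l mod g)) (of_nat l)) \<longlonglongrightarrow> 0"
    using assms unfolding quasi_polynomial_growth_def by blast
  from tendsto_mult_right[OF Q, of c] show ?thesis
    by (intro quasi_polynomial_growthI[where Q = "\<lambda>s. Polynomial.smult c (Q s)"]) (simp add: algebra_simps)
qed

text \<open>
  For \<open>\<bar>ev\<bar> < \<rho>\<close> the zero polynomials will do. Otherwise \<open>(ev / \<rho>) ^ l\<close> depends on \<open>l mod g\<close> only, and what remains is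
  the polynomial \<open>l choose d\<close>.
\<close>

lemma quasi_polynomial_growth_binomial_geometric:
  fixes ev :: complex
  assumes "0 < \<rho>" "cmod ev \<le> \<rho>" "cmod ev = \<rho> \<Longrightarrow> ev ^ g = of_real \<rho> ^ g"
  shows "quasi_polynomial_growth g \<rho> (\<lambda>l. of_nat (l choose d) * ev ^ (l - d))"
proof (cases "cmod ev = \<rho>")
  case False
  with assms(2) have "cmod ev < \<rho>" by simp
  from binomial_geometric_negligible[OF this, of d]
  show ?thesis by (intro quasi_polynomial_growthI[where Q = "\<lambda>s. 0"]) simp
next
  case True
  then have "ev \<noteq> 0" using assms(1) by auto
  define z where "z = ev / of_real \<rho>"
  have "z ^ g = 1" using assms(1) assms(3)[OF True] by (simp add: z_def power_divide)
  then have z_mod: "z ^ l = z ^ (l mod g)" for l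
    by (metis div_mult_mod_eq mult.left_neutral power_add power_mult power_one mult.commute)
  obtain p :: "complex poly" where p: "\<And>l. poly p (of_nat l) = of_nat (l choose d)"
    using binomial_polynomial by blast
  define Q where "Q = (\<lambda>s. Polynomial.smult (z ^ s / ev ^ d) p)"
  have "\<forall>\<^sub>F l in sequentially. of_nat (l choose d) * ev ^ (l - d) / of_real \<rho> ^ l
      - poly (Q (l mod g)) (of_nat l) = 0"
    using eventually_ge_at_top[of d]
  proof eventually_elim
    case (elim l)
    have "ev ^ (l - d) / of_real \<rho> ^ l = z ^ l / ev ^ d"
      using \<open>ev \<noteq> 0\<close> elim by (simp add: z_def power_diff power_divide)
    then have "of_nat (l choose d) * ev ^ (l - d) / of_real \<rho> ^ l =
        of_nat (l choose d) * (z ^ l / ev ^ d)"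
      by (metis times_divide_eq_right)
    then show ?case
      by (simp add: Q_def p z_mod[of l, symmetric])
  qed
  then show ?thesis
    by (intro quasi_polynomial_growthI[of _ _ Q]) (rule tendsto_eventually)
qed

lemma Re_poly_of_real: "Re (poly p (of_real x)) = poly (map_poly Re p) x"
  by (induction p) (simp_all add: map_poly_pCons)

lemma real_quasi_polynomial_growth:
  fixes f :: "nat \<Rightarrow> real"
  assumes "quasi_polynomial_growth g \<rho> (\<lambda>l. of_real (f l))"
  obtains Q :: "nat \<Rightarrow> real poly"
    where "(\<lambda>l. f l / \<rho> ^ l - poly (Q (l mod g)) (real l)) \<longlonglongrightarrow> 0"
proof -
  obtain Q :: "nat \<Rightarrow> complex poly" where
    Q: "(\<lambda>l. of_real (f l) / of_real \<rho> ^ l - poly (Q (l mod g)) (of_nat l)) \<longlonglongrightarrow> 0"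
    using assms unfolding quasi_polynomial_growth_def by blast
  have "Re (of_real (f l) / of_real \<rho> ^ l - poly (Q (l mod g)) (of_nat l)) =
      f l / \<rho> ^ l - poly (map_poly Re (Q (l mod g))) (real l)" for l
    by (simp add: Re_poly_of_real[symmetric] flip: of_real_power of_real_divide)
  with tendsto_Re[OF Q] show thesis
    by (intro that[of "\<lambda>s. map_poly Re (Q s)"]) simp
qed

lemma eventually_positive_if_lead_coeff_pos:
  assumes "0 < lead_coeff p"
  shows "eventually_positive p"
proof -
  obtain b where b: "\<And>x. b \<le> x \<Longrightarrow> lead_coeff p \<le> poly p x"
    using poly_pinfty_gt_lc[OF assms] by blast
  show ?thesis unfolding eventually_positive_def
  proof (intro exI allI impI)
    fix l assume "nat \<lceil>b\<rceil> \<le> l"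
    then show "0 < poly p (real l)" using b[of "real l"] assms by linarith
  qed
qed

text \<open>
  With a negative leading coefficient the negated polynomial would be eventually positive.
\<close>

lemma lead_coeff_pos_if_frequently_pos:
  assumes "\<exists>\<^sub>F l in sequentially. 0 < poly p (real l)"
  shows "0 < lead_coeff p"
proof (rule ccontr)
  assume "\<not> 0 < lead_coeff p"
  moreover have "p \<noteq> 0" using assms by (auto dest: frequently_ex)
  ultimately have "0 < lead_coeff (- p)" by (simp add: order_less_le)
  then have "eventually_positive (- p)" by (rule eventually_positive_if_lead_coeff_pos)
  then have "\<forall>\<^sub>F l in sequentially. \<not> 0 < poly p (real l)"
    unfolding eventually_positive_def eventually_sequentially by force
  with assms show False by (simp add: frequently_def)
qed

text \<open>
  The two bounds force equal degrees: the quotient of a polynomial by one of larger degree tends to 0.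
\<close>

lemma poly_ratio_tendsto:
  fixes p q :: "real poly"
  assumes "0 < lead_coeff p" "0 < lead_coeff q"
    and "\<exists>\<^sub>F l in sequentially. poly p (real l) \<le> C * poly q (real l)"
    and "\<exists>\<^sub>F l in sequentially. poly q (real l) \<le> C * poly p (real l)"
  shows "(\<lambda>l. poly p (real l) / poly q (real l)) \<longlonglongrightarrow> lead_coeff p / lead_coeff q"
proof -
  have at_inf: "filterlim real at_infinity sequentially"
    using filterlim_real_sequentially filterlim_mono[OF _ at_top_le_at_infinity order_refl] by blast
  have degree_le: "degree a \<le> degree b"
    if "0 < lead_coeff a" "\<exists>\<^sub>F l in sequentially. poly a (real l) \<le> C * poly b (real l)"
    for a b :: "real poly"
  proof (rule ccontr)
    assume "\<not> degree a \<le> degree b"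
    then have "((\<lambda>x. poly b x / poly a x) \<longlongrightarrow> 0) at_infinity"
      by (intro poly_divide_tendsto_0_at_infinity) simp
    then have "(\<lambda>l. poly b (real l) / poly a (real l)) \<longlonglongrightarrow> 0"
      using at_inf by (rule filterlim_compose)
    then have "(\<lambda>l. C * (poly b (real l) / poly a (real l))) \<longlonglongrightarrow> C * 0"
      by (intro tendsto_intros)
    then have "\<forall>\<^sub>F l in sequentially. C * (poly b (real l) / poly a (real l)) < 1"
      by (rule order_tendstoD) simp
    moreover have "\<forall>\<^sub>F l in sequentially. 0 < poly a (real l)"
      using eventually_positive_if_lead_coeff_pos[OF that(1)]
      unfolding eventually_positive_def eventually_sequentially .
    ultimately have "\<forall>\<^sub>F l in sequentially. \<not> poly a (real l) \<le> C * poly b (real l)"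
      by eventually_elim (simp add: field_simps)
    with that(2) show False by (simp add: frequently_def)
  qed
  have deg: "degree p = degree q"
    using degree_le[OF assms(1,3)] degree_le[OF assms(2,4)] by simp
  have "(\<lambda>l. poly a (real l) / real l ^ degree a) \<longlonglongrightarrow> lead_coeff a" for a :: "real poly"
    using poly_divide_tendsto_aux at_inf by (rule filterlim_compose)
  then have "(\<lambda>l. (poly p (real l) / real l ^ degree p) / (poly q (real l) / real l ^ degree q))
      \<longlonglongrightarrow> lead_coeff p / lead_coeff q"
    using assms(2) by (intro tendsto_divide) auto
  moreover have "\<forall>\<^sub>F l in sequentially. (poly p (real l) / real l ^ degree p) /
      (poly q (real l) / real l ^ degree q) = poly p (real l) / poly q (real l)"
    using eventually_gt_at_top[of 0] by eventually_elim (simp add: deg)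
  ultimately show ?thesis by (simp add: tendsto_cong)
qed

section \<open>Counting walks\<close>

text \<open>
  These are the entries of the powers of the adjacency matrix, but indexed by nodes. This makes different
  networks comparable, whose node numberings are unrelated.
\<close>

definition walk_count :: "('a,'b) pre_digraph \<Rightarrow> nat \<Rightarrow> 'a \<Rightarrow> 'a \<Rightarrow> nat" where
  "walk_count G l u v = card {p. pre_digraph.awalk G u p v \<and> length p = l}"

context fin_digraph
begin

lemma finite_walks_of_length: "finite {p. awalk u p v \<and> length p = l}"
  by (rule finite_subset[OF _ finite_lists_length_eq[of "arcs G" l]]) (auto simp: awalk_def)

lemma walk_count_0: "walk_count G 0 u v = (if u = v \<and> u \<in> verts G then 1 else 0)"
proof -
  have "{p. awalk u p v \<and> length p = 0} = (if u = v \<and> u \<in> verts G then {[]} else {})"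
    by (auto simp: awalk_Nil_iff)
  then show ?thesis by (auto simp: walk_count_def)
qed

lemma walk_count_1: "walk_count G 1 u v = card {e \<in> arcs G. tail G e = u \<and> head G e = v}"
proof -
  have "{p. awalk u p v \<and> length p = 1} = (\<lambda>e. [e]) ` {e \<in> arcs G. tail G e = u \<and> head G e = v}"
    by (auto simp: length_Suc_conv awalk_simps)
  moreover have "inj_on (\<lambda>e. [e]) S" for S :: "'b set" by (simp add: inj_on_def)
  ultimately show ?thesis by (simp add: walk_count_def card_image)
qed

text \<open>
  A walk of length \<open>k + l\<close> splits uniquely after \<open>k\<close> arcs, and \<open>w\<close> is the node reached there.
\<close>

lemma walk_count_add:
  "walk_count G (k + l) u v = (\<Sum>w\<in>verts G. walk_count G k u w * walk_count G l w v)"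
proof -
  let ?W = "\<lambda>l u v. {p. awalk u p v \<and> length p = l}"
  have "?W (k + l) u v = (\<Union>w\<in>verts G. (\<lambda>(p, q). p @ q) ` (?W k u w \<times> ?W l w v))"
  proof (intro equalityI subsetI)
    fix p assume p: "p \<in> ?W (k + l) u v"
    let ?w = "awlast u (take k p)"
    have "awalk u (take k p @ drop k p) v" using p by simp
    then have "awalk u (take k p) ?w" "awalk ?w (drop k p) v"
      unfolding awalk_append_iff by blast+
    moreover from this have "?w \<in> verts G" by auto
    ultimately show "p \<in> (\<Union>w\<in>verts G. (\<lambda>(p, q). p @ q) ` (?W k u w \<times> ?W l w v))"
      using p by (intro UN_I[of ?w] image_eqI[of _ _ "(take k p, drop k p)"]) auto
  next
    fix p assume "p \<in> (\<Union>w\<in>verts G. (\<lambda>(p, q). p @ q) ` (?W k u w \<times> ?W l w v))"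
    then show "p \<in> ?W (k + l) u v" by (auto intro: awalk_appendI simp del: awalk_append_iff)
  qed
  also have "card \<dots> = (\<Sum>w\<in>verts G. card ((\<lambda>(p, q). p @ q) ` (?W k u w \<times> ?W l w v)))"
  proof (intro card_UN_disjoint ballI impI)
    fix w w' :: 'a assume "w \<noteq> w'"
    show "(\<lambda>(p, q). p @ q) ` (?W k u w \<times> ?W l w v) \<inter>
        (\<lambda>(p, q). p @ q) ` (?W k u w' \<times> ?W l w' v) = {}" (is "?L \<inter> ?R = {}")
    proof (intro equals0I, elim IntE)
      fix r assume "r \<in> ?L" "r \<in> ?R"
      then have "awalk u (take k r) w" "awalk u (take k r) w'"
        by (elim imageE SigmaE CollectE conjE;
            simp del: awalk_append_iff awends_of_awalk)+
      then show False using awalk_ends[of u _ w u w'] \<open>w \<noteq> w'\<close> by blast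
    qed
  qed (simp_all add: finite_walks_of_length)
  also have "\<dots> = (\<Sum>w\<in>verts G. walk_count G k u w * walk_count G l w v)"
  proof (rule sum.cong[OF refl])
    fix w
    have "inj_on (\<lambda>(p, q). p @ q) (?W k u w \<times> ?W l w v)"
      by (auto simp: inj_on_def)
    then show "card ((\<lambda>(p, q). p @ q) ` (?W k u w \<times> ?W l w v)) = walk_count G k u w * walk_count G l w v"
      by (simp add: card_image walk_count_def card_cartesian_product)
  qed
  finally show ?thesis by (simp add: walk_count_def)
qed

lemma walk_count_Suc:
  "walk_count G (Suc l) u v = (\<Sum>w\<in>verts G. walk_count G 1 u w * walk_count G l w v)"
  using walk_count_add[of 1 l u v] by simp

lemma walk_count_pos_iff: "0 < walk_count G l u v \<longleftrightarrow> (\<exists>p. awalk u p v \<and> length p = l)"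
  using finite_walks_of_length[of u v l] by (auto simp: walk_count_def card_gt_0_iff)

lemma reachable_walk_count: "u \<rightarrow>\<^sup>* v \<longleftrightarrow> (\<exists>l. 0 < walk_count G l u v)"
  by (auto simp: walk_count_pos_iff reachable_awalk)

lemma num_walks_to_eq_sum: "num_walks_to G i l = (\<Sum>u\<in>verts G. walk_count G l u i)"
proof -
  have "{p. length p = l \<and> (\<exists>j. awalk j p i)} = (\<Union>u\<in>verts G. {p. awalk u p i \<and> length p = l})"
    by auto
  also have "card \<dots> = (\<Sum>u\<in>verts G. card {p. awalk u p i \<and> length p = l})"
    by (intro card_UN_disjoint) (auto simp: finite_walks_of_length dest: awalk_ends)
  finally show ?thesis by (simp add: num_walks_to_def walk_count_def)
qed

lemma node_list: "distinct (node_list G)" "set (node_list G) = verts G"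
proof -
  have "\<exists>xs. distinct xs \<and> set xs = verts G"
    using finite_distinct_list[OF finite_verts] by blast
  then have "distinct (node_list G) \<and> set (node_list G) = verts G"
    unfolding node_list_def by (rule someI_ex)
  then show "distinct (node_list G)" "set (node_list G) = verts G" by auto
qed

lemma length_node_list: "length (node_list G) = card (verts G)"
  using node_list distinct_card by metis

lemma sum_node_list: "(\<Sum>b<card (verts G). f (node_list G ! b)) = (\<Sum>v\<in>verts G. f v)"
proof -
  have "bij_betw ((!) (node_list G)) {..<card (verts G)} (verts G)"
    using node_list by (intro bij_betw_nth) (simp_all add: length_node_list)
  then show ?thesis by (rule sum.reindex_bij_betw)
qed

lemma node_list_in_verts: "a < card (verts G) \<Longrightarrow> node_list G ! a \<in> verts G"
  using node_list(2) nth_mem[of a "node_list G"] by (simp add: length_node_list)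

lemma obtain_node_index:
  assumes "v \<in> verts G"
  obtains a where "a < card (verts G)" "node_list G ! a = v"
  using assms node_list(2) by (metis in_set_conv_nth length_node_list)

lemma adjacency_matrix_carrier: "adjacency_matrix G \<in> carrier_mat (card (verts G)) (card (verts G))"
  by (simp add: adjacency_matrix_def)

lemma adjacency_matrix_index:
  assumes "a < card (verts G)" "b < card (verts G)"
  shows "adjacency_matrix G $$ (a, b) = walk_count G 1 (node_list G ! a) (node_list G ! b)"
  unfolding walk_count_1 using assms by (simp add: adjacency_matrix_def)

lemma adjacency_matrix_pow_index:
  assumes "a < card (verts G)" "b < card (verts G)"
  shows "(adjacency_matrix G ^\<^sub>m l) $$ (a, b) = walk_count G l (node_list G ! a) (node_list G ! b)"
  using assms
proof (induction l arbitrary: a b)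
  case 0
  then show ?case
    using node_list_in_verts node_list(1)
    by (auto simp: walk_count_0 adjacency_matrix_def nth_eq_iff_index_eq length_node_list)
next
  case (Suc l)
  let ?n = "card (verts G)" and ?A = "adjacency_matrix G"
  have "(?A ^\<^sub>m l) \<in> carrier_mat ?n ?n"
    by (rule pow_carrier_mat[OF adjacency_matrix_carrier])
  then have "(?A ^\<^sub>m Suc l) $$ (a, b) = (\<Sum>c<?n. (?A ^\<^sub>m l) $$ (a, c) * ?A $$ (c, b))"
    using Suc.prems adjacency_matrix_carrier by (auto simp: scalar_prod_def atLeast0LessThan intro!: sum.cong)
  also have "\<dots> = (\<Sum>c<?n. walk_count G l (node_list G ! a) (node_list G ! c)
      * walk_count G 1 (node_list G ! c) (node_list G ! b))"
    using Suc.prems by (intro sum.cong refl) (simp add: Suc.IH adjacency_matrix_index)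
  also have "\<dots> = walk_count G (Suc l) (node_list G ! a) (node_list G ! b)"
    by (simp only: Suc_eq_plus1 walk_count_add
        sum_node_list[of "\<lambda>w. walk_count G l (node_list G ! a) w * walk_count G 1 w (node_list G ! b)"])
  finally show ?case .
qed

end

section \<open>Eigenfunctions of networks\<close>

text \<open>
  An eigenvector of the adjacency matrix, again indexed by nodes: one and the same function can be an
  eigenfunction of a network and, after restriction, of a subnetwork.
\<close>

definition eigenfunction :: "('a,'b) pre_digraph \<Rightarrow> complex \<Rightarrow> ('a \<Rightarrow> complex) \<Rightarrow> bool" where
  "eigenfunction G ev x \<longleftrightarrow> (\<exists>u\<in>verts G. x u \<noteq> 0) \<and>
     (\<forall>u\<in>verts G. (\<Sum>v\<in>verts G. of_nat (walk_count G 1 u v) * x v) = ev * x u)"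

lemma induced_subgraph_walk_count_1:
  assumes "fin_digraph G" "induced_subgraph H G" "u \<in> verts H" "v \<in> verts H"
  shows "walk_count H 1 u v = walk_count G 1 u v"
proof -
  interpret G: fin_digraph G by (rule assms)
  have sub: "subgraph H G" using assms(2) by auto
  interpret H: fin_digraph H by (rule G.fin_digraph_subgraph[OF sub])
  have "{e \<in> arcs H. tail H e = u \<and> head H e = v} = {e \<in> arcs G. tail G e = u \<and> head G e = v}"
  proof -
    have "tail H = tail G" "head H = head G"
      using sub by (simp_all add: subgraph_def compatible_def)
    moreover have "arcs H = {e \<in> arcs G. tail G e \<in> verts H \<and> head G e \<in> verts H}"
      using assms(2) by (simp add: induced_subgraph_def)
    ultimately show ?thesis using assms(3,4) by force
  qed
  then show ?thesis unfolding H.walk_count_1 G.walk_count_1 by simp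
qed

context fin_digraph
begin

abbreviation complex_adjacency :: "complex mat" where
  "complex_adjacency \<equiv> map_mat of_nat (adjacency_matrix G)"

lemma complex_adjacency_carrier: "complex_adjacency \<in> carrier_mat (card (verts G)) (card (verts G))"
  using adjacency_matrix_carrier by simp

lemma complex_adjacency_mult_vec_index:
  assumes "a < card (verts G)" "w \<in> carrier_vec (card (verts G))"
  shows "(complex_adjacency *\<^sub>v w) $ a =
    (\<Sum>b<card (verts G). of_nat (walk_count G 1 (node_list G ! a) (node_list G ! b)) * w $ b)"
  using assms adjacency_matrix_carrier
  by (auto simp: scalar_prod_def atLeast0LessThan adjacency_matrix_index intro!: sum.cong)

lemma eigenvalue_iff_eigenfunction: "eigenvalue complex_adjacency ev \<longleftrightarrow> (\<exists>x. eigenfunction G ev x)"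
proof
  let ?n = "card (verts G)"
  assume "eigenvalue complex_adjacency ev"
  then obtain w where w: "w \<in> carrier_vec ?n" "w \<noteq> 0\<^sub>v ?n" "complex_adjacency *\<^sub>v w = ev \<cdot>\<^sub>v w"
    using adjacency_matrix_carrier by (auto simp: eigenvalue_def eigenvector_def)
  define x where "x v = w $ (THE a. a < ?n \<and> node_list G ! a = v)" for v
  have x: "x (node_list G ! a) = w $ a" if "a < ?n" for a
  proof -
    have "(THE a'. a' < ?n \<and> node_list G ! a' = node_list G ! a) = a"
      using that node_list(1) by (auto simp: nth_eq_iff_index_eq length_node_list)
    then show ?thesis by (simp add: x_def)
  qed
  have "eigenfunction G ev x"
    unfolding eigenfunction_def
  proof
    obtain a where "a < ?n" "w $ a \<noteq> 0" using w(1,2) by (auto simp: vec_eq_iff)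
    then show "\<exists>u\<in>verts G. x u \<noteq> 0" using x node_list_in_verts by metis
    show "\<forall>u\<in>verts G. (\<Sum>v\<in>verts G. of_nat (walk_count G 1 u v) * x v) = ev * x u"
    proof
      fix u assume "u \<in> verts G"
      then obtain a where a: "a < ?n" "node_list G ! a = u" by (rule obtain_node_index)
      have "(\<Sum>v\<in>verts G. of_nat (walk_count G 1 u v) * x v) = (complex_adjacency *\<^sub>v w) $ a"
        using a w(1)
        by (simp only: complex_adjacency_mult_vec_index flip: sum_node_list) (simp add: x)
      also have "\<dots> = ev * x u" unfolding w(3) using a w(1) x by auto
      finally show "(\<Sum>v\<in>verts G. of_nat (walk_count G 1 u v) * x v) = ev * x u" .
    qed
  qed
  then show "\<exists>x. eigenfunction G ev x" by blast
next
  let ?n = "card (verts G)"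
  assume "\<exists>x. eigenfunction G ev x"
  then obtain x where x: "eigenfunction G ev x" ..
  define w where "w = vec ?n (\<lambda>a. x (node_list G ! a))"
  have w: "w \<in> carrier_vec ?n" by (simp add: w_def)
  have "complex_adjacency *\<^sub>v w = ev \<cdot>\<^sub>v w"
  proof (rule eq_vecI)
    fix a assume "a < dim_vec (ev \<cdot>\<^sub>v w)"
    then have a: "a < ?n" using w by simp
    have "(complex_adjacency *\<^sub>v w) $ a =
        (\<Sum>b<?n. of_nat (walk_count G 1 (node_list G ! a) (node_list G ! b)) * x (node_list G ! b))"
      using a w by (simp only: complex_adjacency_mult_vec_index) (simp add: w_def)
    also have "\<dots> = ev * x (node_list G ! a)"
      using x node_list_in_verts[OF a]
      by (simp only: sum_node_list[of "\<lambda>v. of_nat (walk_count G 1 (node_list G ! a) v) * x v"] eigenfunction_def)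
    finally show "(complex_adjacency *\<^sub>v w) $ a = (ev \<cdot>\<^sub>v w) $ a"
      using a by (simp add: w_def)
  qed (use adjacency_matrix_carrier w in auto)
  moreover have "w \<noteq> 0\<^sub>v ?n"
  proof -
    obtain u where "u \<in> verts G" "x u \<noteq> 0" using x by (auto simp: eigenfunction_def)
    then obtain a where "a < ?n" "x (node_list G ! a) \<noteq> 0" by (metis obtain_node_index)
    then show ?thesis by (auto simp: w_def vec_eq_iff)
  qed
  ultimately show "eigenvalue complex_adjacency ev"
    using w adjacency_matrix_carrier unfolding eigenvalue_def eigenvector_def by auto
qed

lemma perron_eigenfunction:
  assumes "verts G \<noteq> {}"
  obtains ev x where "eigenfunction G ev x" "cmod ev = perron_eigenvalue G"
proof -
  have "0 < card (verts G)" using assms by (simp add: card_gt_0_iff)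
  from spectral_radius_mem_max(1)[OF complex_adjacency_carrier this]
  obtain ev where "eigenvalue complex_adjacency ev" "cmod ev = perron_eigenvalue G"
    by (auto simp: spectrum_def perron_eigenvalue_def)
  then show thesis using that eigenvalue_iff_eigenfunction by blast
qed

lemma cmod_eigenvalue_le_perron:
  assumes "eigenfunction G ev x"
  shows "cmod ev \<le> perron_eigenvalue G"
proof -
  have "0 < card (verts G)" using assms by (auto simp: eigenfunction_def card_gt_0_iff)
  moreover have "ev \<in> spectrum complex_adjacency"
    using assms eigenvalue_iff_eigenfunction by (auto simp: spectrum_def)
  ultimately show ?thesis
    unfolding perron_eigenvalue_def
    by (intro spectral_radius_mem_max(2)[OF complex_adjacency_carrier]) auto
qed

lemma eigenfunction_walks:
  assumes "eigenfunction G ev x" "u \<in> verts G"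
  shows "(\<Sum>v\<in>verts G. of_nat (walk_count G l u v) * x v) = ev ^ l * x u"
  using assms(2)
proof (induction l arbitrary: u)
  case 0
  have "(\<Sum>v\<in>verts G. of_nat (walk_count G 0 u v) * x v) = (\<Sum>v\<in>verts G. if v = u then x v else 0)"
    using 0 by (intro sum.cong) (auto simp: walk_count_0)
  then show ?case using 0 by simp
next
  case (Suc l)
  have "(\<Sum>v\<in>verts G. of_nat (walk_count G (Suc l) u v) * x v) =
      (\<Sum>v\<in>verts G. \<Sum>w\<in>verts G. of_nat (walk_count G 1 u w) * (of_nat (walk_count G l w v) * x v))"
    by (simp add: walk_count_Suc[of l] sum_distrib_right mult.assoc)
  also have "\<dots> = (\<Sum>w\<in>verts G. of_nat (walk_count G 1 u w) * (\<Sum>v\<in>verts G. of_nat (walk_count G l w v) * x v))"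
    by (subst sum.swap) (simp add: sum_distrib_left)
  also have "\<dots> = (\<Sum>w\<in>verts G. of_nat (walk_count G 1 u w) * (ev ^ l * x w))"
    by (intro sum.cong refl) (simp only: Suc.IH)
  also have "\<dots> = ev ^ l * (\<Sum>w\<in>verts G. of_nat (walk_count G 1 u w) * x w)"
    by (simp add: sum_distrib_left mult_ac)
  also have "\<dots> = ev ^ Suc l * x u"
    using assms(1) Suc.prems by (simp add: eigenfunction_def)
  finally show ?case .
qed

lemma sequence_closure_walk_count:
  fixes P :: "(nat \<Rightarrow> complex) \<Rightarrow> bool"
  assumes zero: "P (\<lambda>l. 0)"
    and add: "\<And>f h. P f \<Longrightarrow> P h \<Longrightarrow> P (\<lambda>l. f l + h l)"
    and scale: "\<And>c f. P f \<Longrightarrow> P (\<lambda>l. c * f l)"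
    and base: "\<And>ev x d. eigenfunction G ev x \<Longrightarrow> P (\<lambda>l. of_nat (l choose d) * ev ^ (l - d))"
    and uv: "u \<in> verts G" "v \<in> verts G"
  shows "P (\<lambda>l. of_nat (walk_count G l u v))"
proof -
  obtain a b where ab: "a < card (verts G)" "node_list G ! a = u" "b < card (verts G)" "node_list G ! b = v"
    using uv by (metis obtain_node_index)
  have "P (\<lambda>l. (complex_adjacency ^\<^sub>m l) $$ (a, b))"
    by (rule sequence_closure_matrix_power[of _ _ P, OF complex_adjacency_carrier zero add scale])
      (use base eigenvalue_iff_eigenfunction ab in blast)+
  moreover have "(complex_adjacency ^\<^sub>m l) $$ (a, b) = of_nat (walk_count G l u v)" for l
  proof -
    have "complex_adjacency ^\<^sub>m l = map_mat of_nat (adjacency_matrix G ^\<^sub>m l)"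
      by (intro semiring_hom.mat_hom_pow[OF _ adjacency_matrix_carrier, symmetric]) (unfold_locales; simp)
    then show ?thesis
      using ab adjacency_matrix_pow_index[of a b l] carrier_matD[OF adjacency_matrix_carrier]
      by (auto simp: pow_mat_dim_square[OF adjacency_matrix_carrier])
  qed
  ultimately show ?thesis by simp
qed

text \<open>
  Every term in the expansion of \<open>walk_count G l u v\<close> has the form \<open>(l choose d) * ev ^ (l - d)\<close> with
  \<open>\<bar>ev\<bar> \<le> perron_eigenvalue G < r\<close>.
\<close>

lemma walk_count_growth:
  assumes "perron_eigenvalue G < r" "u \<in> verts G" "v \<in> verts G"
  shows "(\<lambda>l. real (walk_count G l u v) / r ^ l) \<longlonglongrightarrow> 0"
proof -
  let ?P = "\<lambda>f :: nat \<Rightarrow> complex. (\<lambda>l. f l / of_real r ^ l) \<longlonglongrightarrow> 0"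
  have "?P (\<lambda>l. of_nat (walk_count G l u v))"
  proof (rule sequence_closure_walk_count[of ?P])
    fix f h assume "?P f" "?P h"
    from tendsto_add[OF this] show "?P (\<lambda>l. f l + h l)" by (simp add: add_divide_distrib)
  next
    fix c f assume "?P f"
    from tendsto_mult_left[OF this, of c] show "?P (\<lambda>l. c * f l)" by simp
  next
    fix ev x d assume "eigenfunction G ev x"
    then have "cmod ev < r" using cmod_eigenvalue_le_perron assms(1) by fastforce
    then show "?P (\<lambda>l. of_nat (l choose d) * ev ^ (l - d))" by (rule binomial_geometric_negligible)
  qed (use assms in auto)
  from tendsto_Re[OF this] show ?thesis
    by (simp flip: of_real_power)
qed

text \<open>
  Iterating the inequality yields \<open>r ^ l * y u \<le> (\<Sum>v. walk_count G l u v * y v)\<close>, which contradicts the growth bound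
  if \<open>r\<close> exceeds the Perron eigenvalue.
\<close>

lemma subharmonic_le_perron:
  fixes y :: "'a \<Rightarrow> real"
  assumes "u \<in> verts G" "0 < y u" "0 < r"
    and sub: "\<And>u. u \<in> verts G \<Longrightarrow> r * y u \<le> (\<Sum>v\<in>verts G. walk_count G 1 u v * y v)"
  shows "r \<le> perron_eigenvalue G"
proof (rule ccontr)
  assume "\<not> r \<le> perron_eigenvalue G"
  then have "(\<lambda>l. \<Sum>v\<in>verts G. (walk_count G l u v / r ^ l) * y v) \<longlonglongrightarrow> (\<Sum>v\<in>verts G. 0 * y v)"
    by (intro tendsto_sum tendsto_mult walk_count_growth tendsto_const assms(1)) auto
  then have lim: "(\<lambda>l. \<Sum>v\<in>verts G. (walk_count G l u v / r ^ l) * y v) \<longlonglongrightarrow> 0" by simp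
  have iter: "r ^ l * y u \<le> (\<Sum>v\<in>verts G. walk_count G l u v * y v)" if "u \<in> verts G" for l u
    using that
  proof (induction l arbitrary: u)
    case 0
    have "(\<Sum>v\<in>verts G. walk_count G 0 u v * y v) = (\<Sum>v\<in>verts G. if v = u then y v else 0)"
      using 0 by (intro sum.cong) (auto simp: walk_count_0)
    then show ?case using 0 by simp
  next
    case (Suc l)
    have "r ^ Suc l * y u = r ^ l * (r * y u)" by simp
    also have "\<dots> \<le> r ^ l * (\<Sum>w\<in>verts G. walk_count G 1 u w * y w)"
      using sub[OF Suc.prems] assms(3) by (intro mult_left_mono) auto
    also have "\<dots> = (\<Sum>w\<in>verts G. walk_count G 1 u w * (r ^ l * y w))"
      by (simp add: sum_distrib_left mult_ac)
    also have "\<dots> \<le> (\<Sum>w\<in>verts G. walk_count G 1 u w * (\<Sum>v\<in>verts G. walk_count G l w v * y v))"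
      by (intro sum_mono mult_left_mono Suc.IH) auto
    also have "\<dots> = (\<Sum>v\<in>verts G. \<Sum>w\<in>verts G. walk_count G 1 u w * (walk_count G l w v * y v))"
      by (subst sum.swap) (simp add: sum_distrib_left)
    also have "\<dots> = (\<Sum>v\<in>verts G. walk_count G (Suc l) u v * y v)"
      by (simp add: walk_count_Suc[of l] sum_distrib_right mult.assoc)
    finally show ?case .
  qed
  have "y u \<le> (\<Sum>v\<in>verts G. (walk_count G l u v / r ^ l) * y v)" for l
  proof -
    have "y u \<le> (\<Sum>v\<in>verts G. walk_count G l u v * y v) / r ^ l"
      using iter[OF assms(1), of l] assms(3) by (simp add: pos_le_divide_eq mult.commute)
    then show ?thesis by (simp add: sum_divide_distrib)
  qed
  then have "y u \<le> 0" by (intro LIMSEQ_le_const[OF lim]) auto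
  then show False using assms(2) by simp
qed

text \<open>
  The modulus of an eigenfunction of \<open>H\<close>, extended by 0, is subharmonic on \<open>G\<close>.
\<close>

lemma perron_eigenvalue_induced_subgraph_le:
  assumes "induced_subgraph H G" "verts H \<noteq> {}" "0 < perron_eigenvalue H"
  shows "perron_eigenvalue H \<le> perron_eigenvalue G"
proof -
  have sub: "subgraph H G" using assms(1) by auto
  interpret H: fin_digraph H by (rule fin_digraph_subgraph[OF sub])
  have HG: "verts H \<subseteq> verts G" using sub by auto
  obtain ev x where x: "eigenfunction H ev x" "cmod ev = perron_eigenvalue H"
    using H.perron_eigenfunction[OF assms(2)] .
  define y where "y v = (if v \<in> verts H then cmod (x v) else 0)" for v
  obtain u where u: "u \<in> verts H" "x u \<noteq> 0" using x(1) by (auto simp: eigenfunction_def)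
  show ?thesis
  proof (rule subharmonic_le_perron[of u y])
    fix w assume "w \<in> verts G"
    have sum_eq: "(\<Sum>v\<in>verts G. walk_count G 1 w v * y v) = (\<Sum>v\<in>verts H. walk_count G 1 w v * cmod (x v))"
      using HG by (intro sum.mono_neutral_cong_right) (auto simp: y_def)
    show "perron_eigenvalue H * y w \<le> (\<Sum>v\<in>verts G. walk_count G 1 w v * y v)"
    proof (cases "w \<in> verts H")
      case True
      then have "perron_eigenvalue H * y w = cmod (\<Sum>v\<in>verts H. of_nat (walk_count H 1 w v) * x v)"
        using x by (simp add: y_def eigenfunction_def norm_mult)
      also have "\<dots> \<le> (\<Sum>v\<in>verts H. walk_count H 1 w v * cmod (x v))"
        by (rule order_trans[OF norm_sum]) (simp add: norm_mult)
      also have "\<dots> = (\<Sum>v\<in>verts H. walk_count G 1 w v * cmod (x v))"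
        using True induced_subgraph_walk_count_1[OF fin_digraph assms(1)] by (intro sum.cong) auto
      finally show ?thesis unfolding sum_eq .
    next
      case False
      then show ?thesis by (simp add: y_def sum_nonneg)
    qed
  qed (use u HG assms(3) in \<open>auto simp: y_def\<close>)
qed

text \<open>
  Among the nodes where \<open>x\<close> does not vanish, let \<open>u\<close> be one from which as few nodes as possible can be reached.
  An arc that leaves the component of \<open>u\<close> ends at a node from which \<open>u\<close> cannot be reached, hence from which fewer
  nodes can be reached than from \<open>u\<close>. So \<open>x\<close> vanishes there, and the eigenvalue equation on the component is the one
  of the component itself.
\<close>

lemma eigenfunction_on_scc:
  assumes "eigenfunction G ev x"
  obtains H where "H \<in> sccs" "eigenfunction H ev x"
proof -
  obtain u where u: "u \<in> verts G" "x u \<noteq> 0"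
    and min: "\<And>v. v \<in> verts G \<Longrightarrow> x v \<noteq> 0 \<Longrightarrow> card {w. u \<rightarrow>\<^sup>* w} \<le> card {w. v \<rightarrow>\<^sup>* w}"
  proof -
    obtain u\<^sub>0 where "u\<^sub>0 \<in> verts G \<and> x u\<^sub>0 \<noteq> 0" using assms by (auto simp: eigenfunction_def)
    from ex_has_least_nat[of "\<lambda>u. u \<in> verts G \<and> x u \<noteq> 0", OF this, of "\<lambda>u. card {w. u \<rightarrow>\<^sup>* w}"]
    obtain u where "(u \<in> verts G \<and> x u \<noteq> 0) \<and>
      (\<forall>v. v \<in> verts G \<and> x v \<noteq> 0 \<longrightarrow> card {w. u \<rightarrow>\<^sup>* w} \<le> card {w. v \<rightarrow>\<^sup>* w})"
      by (elim exE)
    then show thesis by (intro that[of u]) simp_all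
  qed
  define H where "H = G \<restriction> scc_of u"
  have H: "H \<in> sccs" "u \<in> verts H"
    using scc_of_in_sccs_verts[OF u(1)] in_sccs_verts_conv in_scc_of_self[OF u(1)] by (auto simp: H_def)
  then have ind: "induced_subgraph H G" by auto
  then have HG: "verts H \<subseteq> verts G" by auto
  have vanish: "walk_count G 1 a v = 0 \<or> x v = 0"
    if "a \<in> verts H" "v \<in> verts G" "v \<notin> verts H" for a v
  proof (rule ccontr)
    assume *: "\<not> ?thesis"
    then have "0 < walk_count G 1 a v" by simp
    then have av: "a \<rightarrow>\<^sup>* v" unfolding reachable_walk_count by (rule exI)
    have ua: "u \<rightarrow>\<^sup>* a" using that(1) by (simp add: H_def scc_of_def)
    from ua av have uv: "u \<rightarrow>\<^sup>* v" by (rule reachable_trans)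
    then have vu: "\<not> v \<rightarrow>\<^sup>* u" using that(3) by (simp add: H_def scc_of_def)
    have "{w. v \<rightarrow>\<^sup>* w} \<subseteq> {w. u \<rightarrow>\<^sup>* w}" using uv reachable_trans by blast
    moreover have "u \<in> {w. u \<rightarrow>\<^sup>* w}" "u \<notin> {w. v \<rightarrow>\<^sup>* w}" using vu u(1) by simp_all
    ultimately have "{w. v \<rightarrow>\<^sup>* w} \<subset> {w. u \<rightarrow>\<^sup>* w}" by blast
    moreover have "finite {w. u \<rightarrow>\<^sup>* w}"
      using reachable_in_verts(2) by (intro finite_subset[OF _ finite_verts]) blast
    ultimately have "card {w. v \<rightarrow>\<^sup>* w} < card {w. u \<rightarrow>\<^sup>* w}" by (intro psubset_card_mono)
    with min[of v] that(2) * show False by simp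
  qed
  have "eigenfunction H ev x"
    unfolding eigenfunction_def
  proof (intro conjI ballI)
    show "\<exists>u\<in>verts H. x u \<noteq> 0" using H(2) u(2) by blast
    fix a assume a: "a \<in> verts H"
    have "(\<Sum>v\<in>verts H. of_nat (walk_count H 1 a v) * x v) = (\<Sum>v\<in>verts H. of_nat (walk_count G 1 a v) * x v)"
      using a induced_subgraph_walk_count_1[OF fin_digraph ind] by (intro sum.cong) auto
    also have "\<dots> = (\<Sum>v\<in>verts G. of_nat (walk_count G 1 a v) * x v)"
      using HG vanish[OF a] by (intro sum.mono_neutral_left) auto
    also have "\<dots> = ev * x a" using assms a HG by (auto simp: eigenfunction_def)
    finally show "(\<Sum>v\<in>verts H. of_nat (walk_count H 1 a v) * x v) = ev * x a" .
  qed
  with H(1) show thesis by (rule that)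
qed

end

section \<open>The peripheral spectrum\<close>

text \<open>
  The exponents \<open>m\<close> with \<open>z ^ m = 1\<close> are the multiples of the least positive one.
\<close>

lemma power_Gcd_eq_1:
  fixes z :: "'a :: monoid_mult" and S :: "nat set"
  assumes "\<And>m. m \<in> S \<Longrightarrow> z ^ m = 1"
  shows "z ^ Gcd S = 1"
proof (cases "\<exists>m>0. z ^ m = 1")
  case False
  with assms have "S \<subseteq> {0}" by auto
  then have "Gcd S = 0" by simp
  then show ?thesis by (simp only: power_0)
next
  case True
  define d where "d = (LEAST m. 0 < m \<and> z ^ m = 1)"
  have d: "0 < d" "z ^ d = 1" using LeastI_ex[OF True] by (auto simp: d_def)
  have "d dvd m" if "z ^ m = 1" for m
  proof -
    have "z ^ m = z ^ (d * (m div d) + m mod d)" by simp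
    then have "z ^ (m mod d) = 1"
      using that d(2) by (simp only: power_add power_mult power_one mult_1_left)
    moreover have "m mod d < d" using d(1) by simp
    ultimately have "m mod d = 0" using not_less_Least[of "m mod d" "\<lambda>m. 0 < m \<and> z ^ m = 1"]
      by (auto simp flip: d_def)
    then show ?thesis by auto
  qed
  then have "d dvd Gcd S" using assms by (intro Gcd_greatest) auto
  then show ?thesis using d(2) by (metis dvd_def power_mult power_one)
qed

text \<open>
  The closed disc with centre \<open>c\<close> and radius \<open>R - c\<close> touches the circle \<open>\<bar>w\<bar> = R\<close> from inside, at the point \<open>R\<close> only.
\<close>

lemma eq_of_real_if_norm_diff_le:
  fixes w :: complex
  assumes "cmod w = R" "0 < c" "cmod (w - of_real c) \<le> R - c"
  shows "w = of_real R"
proof -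
  have "(cmod (w - of_real c))\<^sup>2 \<le> (R - c)\<^sup>2"
    using assms(3) norm_ge_zero by (intro power_mono)
  moreover have "(cmod (w - of_real c))\<^sup>2 = (cmod w)\<^sup>2 - 2 * c * Re w + c\<^sup>2"
    unfolding cmod_power2 by (simp add: power2_eq_square algebra_simps)
  ultimately have "2 * c * R \<le> 2 * c * Re w"
    using assms(1) by (simp add: power2_eq_square algebra_simps)
  then have "R \<le> Re w" using assms(2) by simp
  then have "Re w = cmod w" using assms(1) complex_Re_le_cmod[of w] by simp
  moreover from this have "Im w = 0" using cmod_power2[of w] by simp
  ultimately show ?thesis using assms(1) by (simp add: complex_eq_iff)
qed

context fin_digraph
begin

text \<open>
  There are finitely many nodes, so \<open>r\<close> can be replaced by a slightly larger number.
\<close>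

lemma less_perron_if_strictly_subharmonic:
  fixes z :: "'a \<Rightarrow> real"
  assumes "verts G \<noteq> {}" "0 \<le> r" "\<And>u. 0 \<le> z u"
    and strict: "\<And>u. u \<in> verts G \<Longrightarrow> r * z u < (\<Sum>v\<in>verts G. walk_count G 1 u v * z v)"
  shows "r < perron_eigenvalue G"
proof -
  define \<delta> where "\<delta> u = (\<Sum>v\<in>verts G. walk_count G 1 u v * z v) - r * z u" for u
  define \<epsilon> where "\<epsilon> = Min (\<delta> ` verts G) / (1 + (\<Sum>v\<in>verts G. z v))"
  have sum: "0 \<le> (\<Sum>v\<in>verts G. z v)" using assms(3) by (simp add: sum_nonneg)
  have Min: "0 < Min (\<delta> ` verts G)" "\<And>u. u \<in> verts G \<Longrightarrow> Min (\<delta> ` verts G) \<le> \<delta> u"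
    using assms(1) strict by (auto simp: \<delta>_def)
  have eps: "0 < \<epsilon>" using Min(1) sum by (simp add: \<epsilon>_def)
  have sub: "(r + \<epsilon>) * z u \<le> (\<Sum>v\<in>verts G. walk_count G 1 u v * z v)" if "u \<in> verts G" for u
  proof -
    have "z u \<le> 1 + (\<Sum>v\<in>verts G. z v)"
      using member_le_sum[OF that, of z] assms(3) by simp
    then have "\<epsilon> * z u \<le> \<epsilon> * (1 + (\<Sum>v\<in>verts G. z v))" using eps by (intro mult_left_mono) auto
    also have "\<dots> = Min (\<delta> ` verts G)" using sum by (simp add: \<epsilon>_def)
    also have "\<dots> \<le> \<delta> u" by (rule Min(2)[OF that])
    finally show ?thesis by (simp add: \<delta>_def algebra_simps)
  qed
  obtain u where u: "u \<in> verts G" "0 < z u"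
  proof (rule ccontr)
    assume "\<not> thesis"
    with that assms(3) have "\<And>u. u \<in> verts G \<Longrightarrow> z u = 0" by (metis order_less_le)
    with strict assms(1) show False by fastforce
  qed
  have "r + \<epsilon> \<le> perron_eigenvalue G"
    by (rule subharmonic_le_perron[of u z]) (use u eps assms(2) sub in auto)
  with eps show ?thesis by simp
qed

text \<open>
  The modulus \<open>y = \<bar>x\<bar>\<close> is subharmonic for the Perron eigenvalue \<open>r\<close> by the triangle inequality. Suppose that
  \<open>r * y u < T y u\<close> at a node \<open>u\<close>, where \<open>T\<close> is multiplication by the adjacency matrix. Let \<open>N\<close> be so large that
  \<open>u\<close> is reached from each node in fewer than \<open>N\<close> steps, and let \<open>z\<close> be the sum of the first \<open>N\<close> iterates of \<open>y\<close> under
  \<open>T\<close>. Then \<open>T z - r * z\<close> is the sum of the first \<open>N\<close> iterates of \<open>T y - r * y\<close> and hence positive everywhere, which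
  would make \<open>r\<close> smaller than itself. So \<open>y\<close> is an eigenfunction for \<open>r\<close>. It vanishes nowhere, because a node at
  which it is positive can be reached from every node.
\<close>

lemma peripheral_eigenfunction_modulus:
  assumes "strongly_connected G" "eigenfunction G ev x" "cmod ev = perron_eigenvalue G" "u \<in> verts G"
  shows "(\<Sum>v\<in>verts G. walk_count G l u v * cmod (x v)) = perron_eigenvalue G ^ l * cmod (x u)"
    and "x u \<noteq> 0"
proof -
  let ?r = "perron_eigenvalue G"
  have nonneg: "0 \<le> ?r" using assms(3) norm_ge_zero by metis
  define y where "y v = cmod (x v)" for v
  define T where "T z u = (\<Sum>v\<in>verts G. walk_count G 1 u v * z v)" for z :: "'a \<Rightarrow> real" and u
  have sub: "?r * y u \<le> T y u" if "u \<in> verts G" for u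
  proof -
    have "?r * y u = cmod (\<Sum>v\<in>verts G. of_nat (walk_count G 1 u v) * x v)"
      using assms(2,3) that by (simp add: y_def eigenfunction_def norm_mult)
    also have "\<dots> \<le> T y u"
      unfolding T_def y_def by (rule order_trans[OF norm_sum]) (simp add: norm_mult)
    finally show ?thesis .
  qed
  have harmonic: "T y u = ?r * y u" if "u \<in> verts G" for u
  proof (rule ccontr)
    assume neq: "T y u \<noteq> ?r * y u"
    have "\<forall>w\<in>verts G. \<exists>k. 0 < walk_count G k w u"
      using assms(1) \<open>u \<in> verts G\<close> by (simp add: strongly_connected_def reachable_walk_count)
    from bchoice[OF this] obtain d where d: "\<And>w. w \<in> verts G \<Longrightarrow> 0 < walk_count G (d w) w u"
      by blast
    define N where "N = Suc (\<Sum>w\<in>verts G. d w)"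
    define z where "z w = (\<Sum>k<N. \<Sum>v\<in>verts G. walk_count G k w v * y v)" for w
    have "?r < ?r"
    proof (rule less_perron_if_strictly_subharmonic[of ?r z])
      fix w assume w: "w \<in> verts G"
      have Tz: "T z w = (\<Sum>k<N. \<Sum>v\<in>verts G. walk_count G k w v * T y v)"
      proof -
        have "T z w = (\<Sum>k<N. \<Sum>v\<in>verts G. \<Sum>v'\<in>verts G. walk_count G 1 w v' * (walk_count G k v' v * y v))"
          unfolding T_def z_def sum_distrib_left
          by (rule trans[OF sum.swap], rule sum.cong[OF refl], rule sum.swap)
        also have "\<dots> = (\<Sum>k<N. \<Sum>v\<in>verts G. walk_count G (1 + k) w v * y v)"
          unfolding walk_count_add[of 1] by (simp add: sum_distrib_right mult.assoc)
        also have "\<dots> = (\<Sum>k<N. \<Sum>v\<in>verts G. \<Sum>v'\<in>verts G. walk_count G k w v' * (walk_count G 1 v' v * y v))"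
          unfolding add.commute[of 1] walk_count_add[of _ 1] by (simp add: sum_distrib_right mult.assoc)
        also have "\<dots> = (\<Sum>k<N. \<Sum>v\<in>verts G. walk_count G k w v * T y v)"
          unfolding T_def sum_distrib_left by (rule sum.cong[OF refl], rule sum.swap)
        finally show ?thesis .
      qed
      have "?r * z w = (\<Sum>k<N. \<Sum>v\<in>verts G. walk_count G k w v * (?r * y v))"
        by (simp add: z_def sum_distrib_left mult_ac)
      also have "\<dots> < (\<Sum>k<N. \<Sum>v\<in>verts G. walk_count G k w v * T y v)"
      proof (rule sum_strict_mono_ex1)
        show "\<forall>k\<in>{..<N}. (\<Sum>v\<in>verts G. walk_count G k w v * (?r * y v))
            \<le> (\<Sum>v\<in>verts G. walk_count G k w v * T y v)"
          by (intro ballI sum_mono mult_left_mono sub) auto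
        have "d w \<le> (\<Sum>w\<in>verts G. d w)" using member_le_sum[OF w, of d] by simp
        then have "d w < N" by (simp add: N_def)
        moreover have "(\<Sum>v\<in>verts G. walk_count G (d w) w v * (?r * y v))
            < (\<Sum>v\<in>verts G. walk_count G (d w) w v * T y v)"
        proof (rule sum_strict_mono_ex1)
          show "\<forall>v\<in>verts G. walk_count G (d w) w v * (?r * y v) \<le> walk_count G (d w) w v * T y v"
            by (intro ballI mult_left_mono sub) auto
          have "?r * y u < T y u" using sub[OF \<open>u \<in> verts G\<close>] neq by simp
          then have "walk_count G (d w) w u * (?r * y u) < walk_count G (d w) w u * T y u"
            using d[OF w] by simp
          then show "\<exists>v\<in>verts G. walk_count G (d w) w v * (?r * y v) < walk_count G (d w) w v * T y v"
            using \<open>u \<in> verts G\<close> by blast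
        qed simp
        ultimately show "\<exists>k\<in>{..<N}. (\<Sum>v\<in>verts G. walk_count G k w v * (?r * y v))
            < (\<Sum>v\<in>verts G. walk_count G k w v * T y v)" by auto
      qed simp
      also have "\<dots> = (\<Sum>v\<in>verts G. walk_count G 1 w v * z v)" 
        by (rule trans[OF Tz[symmetric]]) (simp only: T_def)
      finally show "?r * z w < (\<Sum>v\<in>verts G. walk_count G 1 w v * z v)" .
    next
      show "0 \<le> z w" for w by (simp add: z_def y_def sum_nonneg)
    qed (use nonneg assms(4) in auto)
    then show False by simp
  qed
  have "eigenfunction G (of_real ?r) (\<lambda>v. of_real (y v))"
    unfolding eigenfunction_def
  proof (intro conjI ballI)
    show "\<exists>u\<in>verts G. complex_of_real (y u) \<noteq> 0"
      using assms(2) by (auto simp: eigenfunction_def y_def)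
    fix u assume "u \<in> verts G"
    from arg_cong[OF harmonic[OF this], of complex_of_real]
    show "(\<Sum>v\<in>verts G. of_nat (walk_count G 1 u v) * complex_of_real (y v)) = of_real ?r * of_real (y u)"
      by (simp add: T_def)
  qed
  from arg_cong[OF eigenfunction_walks[OF this], of _ Re]
  have walks: "(\<Sum>v\<in>verts G. walk_count G l u v * y v) = ?r ^ l * y u" if "u \<in> verts G" for l u
    using that by (simp flip: of_real_power)
  then show "(\<Sum>v\<in>verts G. walk_count G l u v * cmod (x v)) = ?r ^ l * cmod (x u)"
    using assms(4) by (simp add: y_def)
  show "x u \<noteq> 0"
  proof
    assume "x u = 0"
    obtain w where w: "w \<in> verts G" "x w \<noteq> 0" using assms(2) by (auto simp: eigenfunction_def)
    obtain k where k: "0 < walk_count G k u w"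
      using assms(1,4) w(1) by (auto simp: strongly_connected_def reachable_walk_count)
    have "0 < walk_count G k u w * y w" using w(2) k by (simp add: y_def)
    also have "\<dots> \<le> (\<Sum>v\<in>verts G. walk_count G k u v * y v)"
      using w(1) by (intro member_le_sum) (auto simp: y_def)
    also have "\<dots> = 0" using walks[OF assms(4)] \<open>x u = 0\<close> by (simp add: y_def)
    finally show False by simp
  qed
qed

text \<open>
  Since \<open>\<bar>x\<bar>\<close> is an eigenfunction too, equality holds in the triangle inequality for the eigenvalue equation of \<open>m\<close>
  steps, and all its terms have the same phase. The term of the closed walks at \<open>u\<close> has the phase of \<open>x u\<close>, their
  sum that of \<open>ev ^ m * x u\<close>. In the proof the closed walks are separated from the rest.
\<close>

lemma peripheral_eigenvalue_return:
  assumes "strongly_connected G" "eigenfunction G ev x" "cmod ev = perron_eigenvalue G"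
    and "u \<in> verts G" "0 < walk_count G m u u"
  shows "ev ^ m = of_real (perron_eigenvalue G) ^ m"
proof -
  let ?r = "perron_eigenvalue G" and ?c = "real (walk_count G m u u)"
  let ?V = "verts G - {u}"
  have xu: "0 < cmod (x u)" using peripheral_eigenfunction_modulus(2)[OF assms(1-4)] by simp
  have split: "(\<Sum>v\<in>verts G. f v) = f u + (\<Sum>v\<in>?V. f v)" for f :: "'a \<Rightarrow> 'c :: comm_monoid_add"
    using assms(4) by (simp add: sum.remove)
  \<comment> \<open>on the right, the walks of length \<open>m\<close> from \<open>u\<close> that end elsewhere\<close>
  have "(ev ^ m - of_real ?c) * x u = (\<Sum>v\<in>?V. of_nat (walk_count G m u v) * x v)"
    using eigenfunction_walks[OF assms(2,4), of m] unfolding split by (simp add: algebra_simps)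
  then have "cmod (ev ^ m - of_real ?c) * cmod (x u) = cmod (\<Sum>v\<in>?V. of_nat (walk_count G m u v) * x v)"
    by (metis norm_mult)
  also have "\<dots> \<le> (\<Sum>v\<in>?V. walk_count G m u v * cmod (x v))"
    by (rule order_trans[OF norm_sum]) (simp add: norm_mult)
  also have "\<dots> = (?r ^ m - ?c) * cmod (x u)"
    using peripheral_eigenfunction_modulus(1)[OF assms(1-4), of m] unfolding split
    by (simp add: algebra_simps)
  finally have "cmod (ev ^ m - of_real ?c) \<le> ?r ^ m - ?c" using xu by simp
  then have "ev ^ m = of_real (?r ^ m)"
    using assms(3,5) by (intro eq_of_real_if_norm_diff_le[of _ _ ?c]) (auto simp: norm_power)
  then show ?thesis by simp
qed

lemma peripheral_eigenvalue_period:
  assumes "strongly_connected G" "eigenfunction G ev x" "cmod ev = perron_eigenvalue G"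
  shows "ev ^ period (adjacency_matrix G) = of_real (perron_eigenvalue G) ^ period (adjacency_matrix G)"
proof (cases "perron_eigenvalue G = 0")
  case True
  then show ?thesis using assms(3) by simp
next
  case False
  let ?r = "perron_eigenvalue G"
  have n: "0 < card (verts G)" using assms(1) by (simp add: strongly_connected_def card_gt_0_iff)
  have "(ev / of_real ?r) ^ period (adjacency_matrix G) = 1"
    unfolding period_def
  proof (rule power_Gcd_eq_1, clarify)
    fix m assume "0 < (adjacency_matrix G ^\<^sub>m m) $$ (0, 0)"
    then have "ev ^ m = of_real ?r ^ m"
      using n by (intro peripheral_eigenvalue_return[OF assms, of "node_list G ! 0"])
        (simp_all add: adjacency_matrix_pow_index node_list_in_verts)
    then show "(ev / of_real ?r) ^ m = 1" using False by (simp add: power_divide)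
  qed
  then show ?thesis using False by (simp add: power_divide)
qed

text \<open>
  The component \<open>H\<close> that carries the eigenfunction has an eigenvalue of modulus \<open>perron_eigenvalue G\<close>, and as a
  subnetwork it cannot have a larger one. So its period is one of those whose multiple is taken.
\<close>

lemma peripheral_eigenvalue_perron_period_lcm:
  assumes "eigenfunction G ev x" "cmod ev = perron_eigenvalue G" "0 < perron_eigenvalue G"
  shows "ev ^ perron_period_lcm G = of_real (perron_eigenvalue G) ^ perron_period_lcm G"
proof -
  obtain H where H: "H \<in> sccs" "eigenfunction H ev x"
    using eigenfunction_on_scc[OF assms(1)] .
  then have ind: "induced_subgraph H G" and sc: "strongly_connected H" by auto
  interpret H: fin_digraph H using ind by (intro fin_digraph_subgraph) auto
  have "perron_eigenvalue G \<le> perron_eigenvalue H"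
    using H.cmod_eigenvalue_le_perron[OF H(2)] assms(2) by simp
  moreover from this have "perron_eigenvalue H \<le> perron_eigenvalue G"
    using assms(3) sc by (intro perron_eigenvalue_induced_subgraph_le[OF ind])
      (auto simp: strongly_connected_def)
  ultimately have eq: "perron_eigenvalue H = perron_eigenvalue G" by simp
  have "period (adjacency_matrix H) dvd perron_period_lcm G"
    unfolding perron_period_lcm_def using H(1) eq by (intro dvd_Lcm) auto
  then obtain q where "perron_period_lcm G = period (adjacency_matrix H) * q" ..
  then show ?thesis
    using H.peripheral_eigenvalue_period[OF sc H(2)] assms(2) eq by (simp add: power_mult)
qed

end

section \<open>Walks that end at a node\<close>

lemma quasi_polynomial_growth_sum:
  assumes "\<And>u. u \<in> S \<Longrightarrow> quasi_polynomial_growth g \<rho> (f u)"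
  shows "quasi_polynomial_growth g \<rho> (\<lambda>l. \<Sum>u\<in>S. f u l)"
  using assms
  by (induction S rule: infinite_finite_induct)
    (simp_all add: quasi_polynomial_growth_zero quasi_polynomial_growth_add)

context fin_digraph
begin

text \<open>
  Let \<open>y v\<close> be the number of walks from \<open>v\<close> to \<open>u\<close> of length less than \<open>m\<close>. One more step turns it into the number of
  walks of lengths \<open>1\<close> to \<open>m\<close>. This loses the empty walk at \<open>u\<close> at most, which the closed walk of length \<open>m\<close> makes up
  for, so that \<open>y\<close> is subharmonic for 1.
\<close>

lemma perron_eigenvalue_ge_1:
  assumes "0 < walk_count G m u u" "0 < m"
  shows "1 \<le> perron_eigenvalue G"
proof -
  have u: "u \<in> verts G" using assms(1) by (auto simp: walk_count_pos_iff)
  define y where "y v = real (\<Sum>k<m. walk_count G k v u)" for v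
  show ?thesis
  proof (rule subharmonic_le_perron[of u y])
    have "walk_count G 0 u u \<le> (\<Sum>k<m. walk_count G k u u)"
      using assms(2) by (intro member_le_sum) auto
    then have "0 < (\<Sum>k<m. walk_count G k u u)" using u by (simp add: walk_count_0)
    then show "0 < y u" unfolding y_def by (simp only: of_nat_0_less_iff)
    fix v assume "v \<in> verts G"
    have "(\<Sum>k<m. walk_count G k v u) + walk_count G m v u =
        walk_count G 0 v u + (\<Sum>k<m. walk_count G (Suc k) v u)"
      using sum.lessThan_Suc_shift[of "\<lambda>k. walk_count G k v u" m] by simp
    moreover have "walk_count G 0 v u \<le> walk_count G m v u"
      using assms(1) by (simp add: walk_count_0)
    ultimately have "(\<Sum>k<m. walk_count G k v u) \<le> (\<Sum>k<m. walk_count G (Suc k) v u)" by linarith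
    also have "\<dots> = (\<Sum>w\<in>verts G. walk_count G 1 v w * (\<Sum>k<m. walk_count G k w u))"
      unfolding walk_count_Suc sum_distrib_left by (rule sum.swap)
    finally have "y v \<le> real (\<Sum>w\<in>verts G. walk_count G 1 v w * (\<Sum>k<m. walk_count G k w u))"
      unfolding y_def by (rule of_nat_mono)
    then show "1 * y v \<le> (\<Sum>w\<in>verts G. walk_count G 1 v w * y w)"
      by (simp add: y_def)
  qed (use u in auto)
qed

text \<open>
  Append a fixed walk of length \<open>d\<close> from \<open>u\<close> to \<open>v\<close>, then delete the first \<open>d\<close> arcs. The first step is injective, and a
  given walk results from at most \<open>K\<close> walks in the second one. Both walk counts refer to the same length, which
  keeps residue classes apart.
\<close>

lemma num_walks_to_le_if_reachable:
  assumes "u \<rightarrow>\<^sup>* v"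
  obtains K where "0 < K" "\<And>l. real (num_walks_to G u l) \<le> K * real (num_walks_to G v l)"
proof -
  obtain d where d: "0 < walk_count G d u v" using assms by (auto simp: reachable_walk_count)
  have u: "u \<in> verts G" using assms by (rule reachable_in_verts)
  define K where "K = (\<Sum>w\<in>verts G. \<Sum>a\<in>verts G. walk_count G d a w)"
  \<comment> \<open>the successor only makes the constant positive\<close>
  have "num_walks_to G u l \<le> Suc K * num_walks_to G v l" for l
  proof -
    have "num_walks_to G u l \<le> (\<Sum>a\<in>verts G. walk_count G l a u * walk_count G d u v)"
      unfolding num_walks_to_eq_sum using d by (intro sum_mono) simp
    also have "\<dots> \<le> (\<Sum>a\<in>verts G. walk_count G (l + d) a v)"
      unfolding walk_count_add using u
      by (intro sum_mono member_le_sum[of u _ "\<lambda>w. walk_count G l _ w * walk_count G d w v"]) auto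
    also have "\<dots> = (\<Sum>a\<in>verts G. \<Sum>w\<in>verts G. walk_count G d a w * walk_count G l w v)"
      unfolding add.commute[of l d] walk_count_add ..
    also have "\<dots> = (\<Sum>w\<in>verts G. (\<Sum>a\<in>verts G. walk_count G d a w) * walk_count G l w v)"
      by (subst sum.swap) (simp add: sum_distrib_right)
    also have "\<dots> \<le> (\<Sum>w\<in>verts G. K * walk_count G l w v)"
      unfolding K_def
      by (intro sum_mono mult_right_mono member_le_sum[of _ _ "\<lambda>w. \<Sum>a\<in>verts G. walk_count G d a w"]) auto
    also have "\<dots> \<le> Suc K * num_walks_to G v l"
      by (simp add: num_walks_to_eq_sum sum_distrib_left)
    finally show ?thesis .
  qed
  then have "real (num_walks_to G u l) \<le> real (Suc K) * real (num_walks_to G v l)" for l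
    by (metis of_nat_le_iff of_nat_mult)
  then show thesis by (intro that[of "real (Suc K)"]) simp_all
qed

text \<open>
  If \<open>x\<close> is an eigenfunction for an eigenvalue of modulus \<open>r\<close>, then \<open>\<bar>x u\<bar> * r ^ l\<close> is at most the number of walks of
  length \<open>l\<close> from \<open>u\<close>, weighted by \<open>\<bar>x\<bar>\<close> at their ends. All these ends lead to \<open>i\<close>.
\<close>

lemma num_walks_to_lower_bound:
  assumes "i \<in> verts G" "\<And>u. u \<in> verts G \<Longrightarrow> u \<rightarrow>\<^sup>* i"
  obtains c where "0 < c" "\<And>l. c * perron_eigenvalue G ^ l \<le> real (num_walks_to G i l)"
proof -
  let ?r = "perron_eigenvalue G"
  obtain ev x where x: "eigenfunction G ev x" "cmod ev = ?r"
    using perron_eigenfunction assms(1) by blast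
  obtain u where u: "u \<in> verts G" "x u \<noteq> 0" using x(1) by (auto simp: eigenfunction_def)
  have "\<forall>v\<in>verts G. \<exists>K. 0 < K \<and> (\<forall>l. real (num_walks_to G v l) \<le> K * real (num_walks_to G i l))"
    using assms(2) num_walks_to_le_if_reachable by metis
  from bchoice[OF this] obtain K where K: "\<And>v. v \<in> verts G \<Longrightarrow> 0 < K v"
    "\<And>v l. v \<in> verts G \<Longrightarrow> real (num_walks_to G v l) \<le> K v * real (num_walks_to G i l)" by blast
  define S where "S = (\<Sum>v\<in>verts G. K v * cmod (x v))"
  have "0 < K u * cmod (x u)" using K(1) u by simp
  also have "\<dots> \<le> S" unfolding S_def
    using u(1) K(1) by (intro member_le_sum[of u _ "\<lambda>v. K v * cmod (x v)"]) (auto simp: less_imp_le)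
  finally have S: "0 < S" .
  have "cmod (x u) * ?r ^ l \<le> S * num_walks_to G i l" for l
  proof -
    have "cmod (x u) * ?r ^ l = cmod (\<Sum>v\<in>verts G. of_nat (walk_count G l u v) * x v)"
      unfolding eigenfunction_walks[OF x(1) u(1)] by (simp add: norm_mult norm_power x(2))
    also have "\<dots> \<le> (\<Sum>v\<in>verts G. walk_count G l u v * cmod (x v))"
      by (rule order_trans[OF norm_sum]) (simp add: norm_mult)
    also have "\<dots> \<le> (\<Sum>v\<in>verts G. (K v * num_walks_to G i l) * cmod (x v))"
    proof (intro sum_mono mult_right_mono)
      fix v assume v: "v \<in> verts G"
      have "walk_count G l u v \<le> num_walks_to G v l"
        unfolding num_walks_to_eq_sum using u(1)
        by (intro member_le_sum[of u _ "\<lambda>u. walk_count G l u v"]) auto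
      then have "real (walk_count G l u v) \<le> real (num_walks_to G v l)" by simp
      also have "\<dots> \<le> K v * num_walks_to G i l" by (rule K(2)[OF v])
      finally show "real (walk_count G l u v) \<le> K v * num_walks_to G i l" .
    qed simp
    also have "\<dots> = S * num_walks_to G i l"
      unfolding S_def sum_distrib_right by (simp add: mult_ac)
    finally show ?thesis .
  qed
  then show thesis using S u(2)
    by (intro that[of "cmod (x u) / S"]) (simp_all add: field_simps)
qed

lemma num_walks_to_quasi_polynomial:
  assumes "0 < perron_eigenvalue G" "i \<in> verts G"
  shows "quasi_polynomial_growth (perron_period_lcm G) (perron_eigenvalue G) (\<lambda>l. of_nat (num_walks_to G i l))"
proof -
  let ?P = "quasi_polynomial_growth (perron_period_lcm G) (perron_eigenvalue G)"
  have "?P (\<lambda>l. of_nat (walk_count G l u i))" if "u \<in> verts G" for u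
  proof (rule sequence_closure_walk_count[of ?P])
    fix ev x d assume "eigenfunction G ev x"
    then show "?P (\<lambda>l. of_nat (l choose d) * ev ^ (l - d))"
      using assms(1) cmod_eigenvalue_le_perron peripheral_eigenvalue_perron_period_lcm
      by (intro quasi_polynomial_growth_binomial_geometric) blast+
  qed (use that assms(2) quasi_polynomial_growth_zero quasi_polynomial_growth_add
      quasi_polynomial_growth_scale in blast)+
  then have "?P (\<lambda>l. \<Sum>u\<in>verts G. of_nat (walk_count G l u i))"
    by (intro quasi_polynomial_growth_sum)
  then show ?thesis by (simp add: num_walks_to_eq_sum)
qed

lemma upstream_eq: "upstream G i = G \<restriction> {j. j \<rightarrow>\<^sup>* i}"
  by (simp add: upstream_def reachable_awalk)

lemma verts_upstream: "verts (upstream G i) = {j. j \<rightarrow>\<^sup>* i}"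
  by (simp add: upstream_eq)

lemma subgraph_upstream: "subgraph (upstream G i) G"
  unfolding upstream_eq using reachable_in_verts(1) by (intro subgraph_induce_subgraphI) blast

lemma fin_digraph_upstream: "fin_digraph (upstream G i)"
  using subgraph_upstream by (rule fin_digraph_subgraph)

lemma awalk_upstream_iff: "pre_digraph.awalk (upstream G i) j p i \<longleftrightarrow> awalk j p i"
proof
  assume "awalk j p i"
  moreover from this have "set (awalk_verts j p) \<subseteq> {j. j \<rightarrow>\<^sup>* i}"
    using awalk_verts_reachable_to by blast
  ultimately show "pre_digraph.awalk (upstream G i) j p i"
    unfolding upstream_eq by (rule awalk_induce)
qed (rule subgraph_awalk_imp_awalk[OF _ subgraph_upstream])

lemma num_walks_to_upstream: "num_walks_to (upstream G i) i = num_walks_to G i"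
  by (simp add: num_walks_to_def awalk_upstream_iff fun_eq_iff)

lemma reachable_upstream:
  assumes "j \<in> verts (upstream G i)"
  shows "j \<rightarrow>\<^sup>*\<^bsub>upstream G i\<^esub> i"
proof -
  interpret U: fin_digraph "upstream G i" by (rule fin_digraph_upstream)
  show ?thesis
    using assms unfolding verts_upstream U.reachable_awalk awalk_upstream_iff
    by (simp add: reachable_awalk)
qed

lemma upstream_eq_if_mutually_reachable:
  assumes "i \<rightarrow>\<^sup>* j" "j \<rightarrow>\<^sup>* i"
  shows "upstream G i = upstream G j"
proof -
  have "{k. k \<rightarrow>\<^sup>* i} = {k. k \<rightarrow>\<^sup>* j}" using assms reachable_trans by blast
  then show ?thesis by (simp add: upstream_eq)
qed

lemma perron_eigenvalue_pos_if_cyclic: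
  assumes "\<not> acyclic_network G"
  shows "0 < perron_eigenvalue G"
proof -
  obtain u p where "awalk u p u" "p \<noteq> []"
    using assms by (auto simp: acyclic_network_def cycle_def)
  then have "0 < walk_count G (length p) u u" "0 < length p"
    by (auto simp: walk_count_pos_iff)
  from perron_eigenvalue_ge_1[OF this] show ?thesis by simp
qed

text \<open>
  All walks that end at \<open>i\<close> stay upstream of \<open>i\<close>, and every upstream node leads to \<open>i\<close> within the upstream network, so
  the expansion and the lower bound apply to it.
\<close>

theorem num_walks_to_upstream_asymptotics:
  assumes "i \<in> verts G" "\<not> acyclic_network (upstream G i)"
  obtains Q :: "nat \<Rightarrow> real poly" and c :: real
  where "0 < c" "0 < perron_eigenvalue (upstream G i)"
    and "\<And>l. c \<le> num_walks_to G i l / perron_eigenvalue (upstream G i) ^ l"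
    and "(\<lambda>l. num_walks_to G i l / perron_eigenvalue (upstream G i) ^ l
      - poly (Q (l mod perron_period_lcm (upstream G i))) (real l)) \<longlonglongrightarrow> 0"
proof -
  let ?U = "upstream G i"
  interpret U: fin_digraph ?U by (rule fin_digraph_upstream)
  have i: "i \<in> verts ?U" using assms(1) by (simp add: verts_upstream)
  have r: "0 < perron_eigenvalue ?U" using assms(2) by (rule U.perron_eigenvalue_pos_if_cyclic)
  obtain c where c: "0 < c" "\<And>l. c * perron_eigenvalue ?U ^ l \<le> real (num_walks_to ?U i l)"
    using U.num_walks_to_lower_bound[OF i reachable_upstream] by blast
  have "quasi_polynomial_growth (perron_period_lcm ?U) (perron_eigenvalue ?U)
      (\<lambda>l. of_real (real (num_walks_to ?U i l)))"
    using U.num_walks_to_quasi_polynomial[OF r i] by simp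
  then obtain Q where "(\<lambda>l. num_walks_to ?U i l / perron_eigenvalue ?U ^ l
      - poly (Q (l mod perron_period_lcm ?U)) (real l)) \<longlonglongrightarrow> 0"
    by (rule real_quasi_polynomial_growth)
  then show thesis
    using c r by (intro that[of c Q]) (simp_all add: num_walks_to_upstream pos_le_divide_eq)
qed

end

section \<open>Polynomials for the residue classes\<close>

lemma frequently_mod_eq:
  assumes "s < g"
  shows "\<exists>\<^sub>F l in sequentially. l mod g = s"
  unfolding frequently_def
proof
  assume "\<forall>\<^sub>F l in sequentially. l mod g \<noteq> s"
  then obtain N where N: "\<And>l. N \<le> l \<Longrightarrow> l mod g \<noteq> s" by (auto simp: eventually_sequentially)
  have "N \<le> g * N" using assms by (cases g) auto
  then have "N \<le> s + g * N" by linarith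
  moreover have "(s + g * N) mod g = s" using assms by simp
  ultimately show False using N by blast
qed

text \<open>
  A limit along all \<open>l\<close> with a parameter \<open>l mod g\<close> comprises the limits along the residue classes, where the parameter
  is constant.
\<close>

lemma tendsto_at_top_cong:
  assumes "s < g" "(\<lambda>l. F (l mod g) l) \<longlonglongrightarrow> L"
  shows "(F s \<longlongrightarrow> L) (at_top_cong s g)"
proof -
  have "((\<lambda>l. F (l mod g) l) \<longlongrightarrow> L) (at_top_cong s g)"
    using assms(2) by (rule tendsto_mono[rotated]) (simp add: at_top_cong_def)
  moreover have "\<forall>\<^sub>F l in at_top_cong s g. F (l mod g) l = F s l"
    using assms(1) by (auto simp: at_top_cong_def eventually_inf_principal cong_def intro: always_eventually)
  ultimately show ?thesis by (simp add: tendsto_cong)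
qed

lemma quasi_polynomial_lower_bound:
  fixes f :: "nat \<Rightarrow> real"
  assumes "0 < c" "\<And>l. c \<le> f l" "(\<lambda>l. f l - poly (Q (l mod g)) (real l)) \<longlonglongrightarrow> 0"
  shows "\<forall>\<^sub>F l in sequentially. c / 2 < poly (Q (l mod g)) (real l)"
proof -
  have "\<forall>\<^sub>F l in sequentially. f l - poly (Q (l mod g)) (real l) < c / 2"
    using order_tendstoD(2)[OF assms(3), of "c / 2"] assms(1) by simp
  then show ?thesis
  proof eventually_elim
    case (elim l)
    then show ?case using assms(2)[of l] by linarith
  qed
qed

text \<open>
  The polynomials stay above \<open>c / 2\<close>, so the additive approximation is also a multiplicative one.
\<close>

lemma quasi_polynomial_ratio_tendsto_1:
  fixes f :: "nat \<Rightarrow> real"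
  assumes "0 < c" "\<And>l. c \<le> f l" "(\<lambda>l. f l - poly (Q (l mod g)) (real l)) \<longlonglongrightarrow> 0"
  shows "(\<lambda>l. f l / poly (Q (l mod g)) (real l)) \<longlonglongrightarrow> 1"
proof -
  have "(\<lambda>l. f l / poly (Q (l mod g)) (real l) - 1) \<longlonglongrightarrow> 0"
  proof (rule tendsto_0_le[OF assms(3), where K = "2 / c"])
    show "\<forall>\<^sub>F l in sequentially. norm (f l / poly (Q (l mod g)) (real l) - 1)
        \<le> norm (f l - poly (Q (l mod g)) (real l)) * (2 / c)"
      using quasi_polynomial_lower_bound[OF assms]
    proof eventually_elim
      case (elim l)
      let ?q = "poly (Q (l mod g)) (real l)"
      have q: "0 < ?q" using elim assms(1) by linarith
      then have "norm (f l / ?q - 1) = \<bar>f l - ?q\<bar> * (1 / ?q)"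
        by (simp add: abs_divide flip: diff_divide_distrib)
          (metis abs_divide abs_of_pos diff_divide_distrib divide_self_if order_less_irrefl)
      also have "\<dots> \<le> \<bar>f l - ?q\<bar> * (2 / c)"
        using q elim assms(1) by (intro mult_left_mono) (auto simp: field_simps)
      finally show ?case by simp
    qed
  qed
  from tendsto_add[OF this tendsto_const[of 1]] show ?thesis by simp
qed

lemma quasi_polynomial_lead_coeff_pos:
  fixes f :: "nat \<Rightarrow> real"
  assumes "0 < c" "\<And>l. c \<le> f l" "(\<lambda>l. f l - poly (Q (l mod g)) (real l)) \<longlonglongrightarrow> 0" "s < g"
  shows "0 < lead_coeff (Q s)"
proof (rule lead_coeff_pos_if_frequently_pos)
  show "\<exists>\<^sub>F l in sequentially. 0 < poly (Q s) (real l)"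
    using frequently_eventually_frequently[OF frequently_mod_eq[OF assms(4)] quasi_polynomial_lower_bound[OF assms(1-3)]]
    by (rule frequently_elim1) (use assms(1) in auto)
qed

text \<open>
  Each function and its polynomial eventually differ by a factor of at most 2, whence the factor 4. The bound \<open>L\<close> in
  place of \<open>K\<close> allows one constant for the estimates in both directions.
\<close>

lemma quasi_polynomials_frequently_le:
  fixes f h :: "nat \<Rightarrow> real"
  assumes f: "0 < c" "\<And>l. c \<le> f l" "(\<lambda>l. f l - poly (Q (l mod g)) (real l)) \<longlonglongrightarrow> 0"
    and h: "0 < d" "\<And>l. d \<le> h l" "(\<lambda>l. h l - poly (R (l mod g)) (real l)) \<longlonglongrightarrow> 0"
    and le: "\<And>l. f l \<le> K * h l" "0 < K" "K \<le> L" and "s < g"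
  shows "\<exists>\<^sub>F l in sequentially. poly (Q s) (real l) \<le> 4 * L * poly (R s) (real l)"
proof -
  have f_ratio: "\<forall>\<^sub>F l in sequentially. 1 / 2 < f l / poly (Q (l mod g)) (real l)"
    by (rule order_tendstoD(1)[OF quasi_polynomial_ratio_tendsto_1[OF f]]) simp
  have h_ratio: "\<forall>\<^sub>F l in sequentially. h l / poly (R (l mod g)) (real l) < 2"
    by (rule order_tendstoD(2)[OF quasi_polynomial_ratio_tendsto_1[OF h]]) simp
  have "\<forall>\<^sub>F l in sequentially. poly (Q (l mod g)) (real l) \<le> 4 * L * poly (R (l mod g)) (real l)"
    using quasi_polynomial_lower_bound[OF f] quasi_polynomial_lower_bound[OF h] f_ratio h_ratio
  proof eventually_elim
    case (elim l)
    let ?q = "poly (Q (l mod g)) (real l)" and ?r = "poly (R (l mod g)) (real l)"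
    have qr: "0 < ?q" "0 < ?r" using elim(1,2) f(1) h(1) by linarith+
    have "?q \<le> 2 * f l" "h l \<le> 2 * ?r" using elim(3,4) qr by (simp_all add: field_simps)
    then have "?q \<le> 2 * (K * h l)" "K * h l \<le> K * (2 * ?r)" using le by (auto intro: order_trans)
    moreover have "K * ?r \<le> L * ?r" using le(3) qr by simp
    ultimately show ?case by linarith
  qed
  from frequently_eventually_frequently[OF frequently_mod_eq[OF \<open>s < g\<close>] this]
  show ?thesis by (rule frequently_elim1) auto
qed

theorem theorem8p3:
  fixes G :: "('a,'b) pre_digraph" and i :: 'a and \<rho> :: real and g :: nat
  assumes "fin_digraph G"
    and "i \<in> verts G"
    and "\<not> acyclic_network (upstream G i)"
    and "\<rho> = perron_eigenvalue (upstream G i)"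
    and "g = perron_period_lcm (upstream G i)"
  shows "\<exists>R :: nat \<Rightarrow> real poly.
    (\<forall>s<g. eventually_positive (R s) \<and> walk_asymptotics G i s g (R s) \<rho>) \<and>
    (\<forall>H \<in> pre_digraph.sccs G. i \<in> verts H \<longrightarrow>
      (\<forall>j \<in> verts H. \<forall>s<g. \<exists>c>0. walk_asymptotics G j s g (Polynomial.smult c (R s)) \<rho>))"
proof -
  interpret fin_digraph G by (rule assms(1))
  define a where "a j l = num_walks_to G j l / \<rho> ^ l" for j l
  have asymptotics: "\<exists>Q c. 0 < c \<and> 0 < \<rho> \<and> (\<forall>l. c \<le> a j l) \<and>
      (\<lambda>l. a j l - poly (Q (l mod g)) (real l)) \<longlonglongrightarrow> 0"
    if "j \<in> verts G" "upstream G j = upstream G i" for j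
  proof -
    have "\<not> acyclic_network (upstream G j)" using assms(3) that(2) by simp
    from num_walks_to_upstream_asymptotics[OF that(1) this] show ?thesis
      unfolding a_def assms(4,5) that(2) by meson
  qed
  obtain R :: "nat \<Rightarrow> real poly" and c where c: "0 < c" and \<rho>: "0 < \<rho>"
    and a_ge: "\<And>l. c \<le> a i l"
    and R: "(\<lambda>l. a i l - poly (R (l mod g)) (real l)) \<longlonglongrightarrow> 0"
    using asymptotics[OF assms(2) refl] by blast
  note R_facts = c a_ge R
  have "eventually_positive (R s)" if "s < g" for s
    using quasi_polynomial_lead_coeff_pos[OF R_facts that] by (rule eventually_positive_if_lead_coeff_pos)
  moreover have "walk_asymptotics G i s g (R s) \<rho>" if "s < g" for s
  proof -
    have "((\<lambda>l. a i l / poly (R s) (real l)) \<longlongrightarrow> 1) (at_top_cong s g)"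
      by (rule tendsto_at_top_cong[OF that, of "\<lambda>s l. a i l / poly (R s) (real l)"])
        (rule quasi_polynomial_ratio_tendsto_1[OF R_facts])
    then show ?thesis unfolding walk_asymptotics_def
      by (intro asymp_equivI') (simp add: a_def mult.commute)
  qed
  moreover have "\<exists>d>0. walk_asymptotics G j s g (Polynomial.smult d (R s)) \<rho>"
    if H: "H \<in> sccs" "i \<in> verts H" "j \<in> verts H" and s: "s < g" for H j s
  proof -
    have "verts H \<in> sccs_verts" using H(1) by (intro in_sccs_vertsI_sccs) auto
    then have reach: "i \<rightarrow>\<^sup>*\<^bsub>G\<^esub> j" "j \<rightarrow>\<^sup>*\<^bsub>G\<^esub> i" using H(2,3) by (auto simp: sccs_verts_def)
    then have j: "j \<in> verts G" using reachable_in_verts(2) by blast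
    have up: "upstream G j = upstream G i"
      using reach by (intro upstream_eq_if_mutually_reachable)
    obtain Q :: "nat \<Rightarrow> real poly" and d where d: "0 < d"
      and a_ge': "\<And>l. d \<le> a j l"
      and Q: "(\<lambda>l. a j l - poly (Q (l mod g)) (real l)) \<longlonglongrightarrow> 0"
      using asymptotics[OF j up] by blast
    note Q_facts = d a_ge' Q
    have compare: "\<exists>K>0. \<forall>l. a u l \<le> K * a v l" if "u \<rightarrow>\<^sup>*\<^bsub>G\<^esub> v" for u v
    proof -
      obtain K where "0 < K" "\<And>l. real (num_walks_to G u l) \<le> K * real (num_walks_to G v l)"
        using num_walks_to_le_if_reachable[OF \<open>u \<rightarrow>\<^sup>*\<^bsub>G\<^esub> v\<close>] by blast
      then show ?thesis using \<rho> by (intro exI[of _ K]) (simp add: a_def divide_right_mono)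
    qed
    obtain K where K: "0 < K" "\<And>l. a j l \<le> K * a i l" using compare[OF reach(2)] by blast
    obtain K' where K': "0 < K'" "\<And>l. a i l \<le> K' * a j l" using compare[OF reach(1)] by blast
    have lead: "0 < lead_coeff (Q s)" "0 < lead_coeff (R s)"
      using quasi_polynomial_lead_coeff_pos[OF Q_facts s] quasi_polynomial_lead_coeff_pos[OF R_facts s] .
    \<comment> \<open>the factor between the walk counts of \<open>j\<close> and \<open>i\<close> in the residue class \<open>s\<close>\<close>
    define q where "q = lead_coeff (Q s) / lead_coeff (R s)"
    have "(\<lambda>l. poly (Q s) (real l) / poly (R s) (real l)) \<longlonglongrightarrow> q"
      unfolding q_def
    proof (rule poly_ratio_tendsto[OF lead])
      show "\<exists>\<^sub>F l in sequentially. poly (Q s) (real l) \<le> 4 * max K K' * poly (R s) (real l)"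
        by (rule quasi_polynomials_frequently_le[OF Q_facts R_facts K(2,1) _ s]) simp
      show "\<exists>\<^sub>F l in sequentially. poly (R s) (real l) \<le> 4 * max K K' * poly (Q s) (real l)"
        by (rule quasi_polynomials_frequently_le[OF R_facts Q_facts K'(2,1) _ s]) simp
    qed
    then have 1: "((\<lambda>l. poly (Q s) (real l) / poly (R s) (real l)) \<longlongrightarrow> q) (at_top_cong s g)"
      by (rule tendsto_mono[rotated]) (simp add: at_top_cong_def)
    have 2: "((\<lambda>l. a j l / poly (Q s) (real l)) \<longlongrightarrow> 1) (at_top_cong s g)"
      by (rule tendsto_at_top_cong[OF s, of "\<lambda>s l. a j l / poly (Q s) (real l)"])
        (rule quasi_polynomial_ratio_tendsto_1[OF Q_facts])
    have "eventually_positive (Q s)" using lead(1) by (rule eventually_positive_if_lead_coeff_pos)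
    then have "\<forall>\<^sub>F l in sequentially. poly (Q s) (real l) \<noteq> 0"
      by (force simp: eventually_positive_def eventually_sequentially)
    then have "\<forall>\<^sub>F l in at_top_cong s g. poly (Q s) (real l) \<noteq> 0"
      by (rule filter_leD[rotated]) (simp add: at_top_cong_def)
    then have "\<forall>\<^sub>F l in at_top_cong s g. a j l / poly (Q s) (real l) * (poly (Q s) (real l) / poly (R s) (real l))
        = a j l / poly (R s) (real l)"
      by eventually_elim simp
    from tendsto_cong[OF this] tendsto_mult[OF 2 1]
    have "((\<lambda>l. a j l / poly (R s) (real l)) \<longlongrightarrow> q) (at_top_cong s g)" by simp
    then have "((\<lambda>l. num_walks_to G j l / (poly (R s) (real l) * \<rho> ^ l)) \<longlongrightarrow> q) (at_top_cong s g)"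
      by (simp add: a_def mult.commute)
    moreover have "0 < q" using lead by (simp add: q_def)
    ultimately have "walk_asymptotics G j s g (Polynomial.smult q (R s)) \<rho>"
      unfolding walk_asymptotics_def using asymp_equivI'_const[of _ _ q] by (simp add: mult.assoc)
    with \<open>0 < q\<close> show ?thesis by blast
  qed
  ultimately show ?thesis by (intro exI[of _ R]) blast
qed

end
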